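(* Let $q$ be an odd prime power and let $h\in\mathbb{F}_{q^6}$ with $h^{q^3+1}=-1$. Assume that it is not the case that both $h\in\mathbb{F}_q$ and $q$ is a power of $5$. Then the linear set $\mathcal{L}_h$ of $\mathrm{PG}(1,q^6)$ is not $\mathrm{P\Gamma L}$-equivalent to any known scattered linear set in $\mathrm{PG}(1,q^6)$; that is, it is not $\mathrm{P\Gamma L}$-equivalent to $L^1$, nor to any $L^2_\delta$, nor to any $L^3_\delta$, nor to any $L^4_\delta$ (with $\delta$ in the admissible range of the respective family).
   Context: For a $q$-polynomial $f(x)=\sum_{i=0}^{5}a_ix^{q^i}\in\mathbb{F}_{q^6}[x]$ let $U_f=\{(x,f(x)):x\in\mathbb{F}_{q^6}\}$ and $L_f=\{\langle \mathbf{u}\rangle_{\mathbb{F}_{q^6}}:\mathbf{u}\in U_f\setminus\{\mathbf 0\}\}\subseteq\mathrm{PG}(1,q^6)$. $L_f$ is maximum scattered if $|L_f|=(q^6-1)/(q-1)$. Two linear sets $L,L'$ of $\mathrm{PG}(1,q^6)$ are $\mathrm{P\Gamma L}$-equivalent if $L^\phi=L'$ for some $\phi\in\mathrm{P\Gamma L}(2,q^6)$. $\mathcal{L}_h:=L_{f_h}$ with $f_h(x)=h^{q-1}x^q-h^{q^2-1}x^{q^2}+x^{q^4}+x^{q^5}$. The known maximum scattered linear sets of $\mathrm{PG}(1,q^6)$ are, with $\mathrm{N}_{q^6/q^e}(\delta)$ denoting the norm of $\delta\in\mathbb{F}_{q^6}$ over $\mathbb{F}_{q^e}$: $L^1$ defined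 by $x^q$; $L^2_\delta$ defined by $\delta x^q+x^{q^5}$ with $\mathrm{N}_{q^6/q}(\delta)\notin\{0,1\}$; $L^3_\delta$ defined by $x^q+\delta x^{q^4}$ with $\mathrm{N}_{q^6/q^3}(\delta)\notin\{0,1\}$ and $\delta,q$ such that $L^3_\delta$ is maximum scattered; $L^4_\delta$ defined by $x^q+x^{q^3}+\delta x^{q^5}$ with $q$ odd and $\delta^2+\delta=1$. *)

theory Defs
  imports
    "HOL-Library.Product_Plus"
    "HOL-Library.FuncSet"
    "HOL-Library.Cardinality"
    "HOL-Number_Theory.Prime_Powers"
begin

text \<open>
  The field of order \<open>q^6\<close> is an arbitrary type \<open>'a\<close> of class \<open>field\<close> and \<open>finite\<close> with
  \<open>CARD('a) = q ^ 6\<close>; the definitions take \<open>q\<close> as a parameter.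
\<close>

subsection \<open>The projective line over a field\<close>

definition scale2 :: "'a::field \<Rightarrow> 'a \<times> 'a \<Rightarrow> 'a \<times> 'a" where
  "scale2 c u = (c * fst u, c * snd u)"

interpretation plane: vector_space "scale2 :: 'a::field \<Rightarrow> 'a \<times> 'a \<Rightarrow> 'a \<times> 'a"
  by unfold_locales (auto simp: scale2_def algebra_simps)

definition PG1 :: "('a::field \<times> 'a) set set" where
  "PG1 = {plane.span {u} | u. u \<noteq> 0}"

definition field_automorphism :: "('a::field \<Rightarrow> 'a) \<Rightarrow> bool" where
  "field_automorphism \<sigma> \<longleftrightarrow>
     bij \<sigma> \<and> (\<forall>x y. \<sigma> (x + y) = \<sigma> x + \<sigma> y) \<and> (\<forall>x y. \<sigma> (x * y) = \<sigma> x * \<sigma> y)"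

definition GammaL2 :: "('a::field \<times> 'a \<Rightarrow> 'a \<times> 'a) set" where
  "GammaL2 = {\<phi>. bij \<phi> \<and> (\<forall>u v. \<phi> (u + v) = \<phi> u + \<phi> v) \<and>
     (\<exists>\<sigma>. field_automorphism \<sigma> \<and> (\<forall>c u. \<phi> (scale2 c u) = scale2 (\<sigma> c) (\<phi> u)))}"

text \<open>
  \<open>P\<Gamma>L(2, F)\<close> as a permutation group on the points. Restricting to \<open>PG1\<close> identifies semilinear
  maps that differ by a nonzero scalar, i.e. this is the quotient of \<open>\<Gamma>L(2, F)\<close> by the scalars.
\<close>

definition PGammaL2 :: "(('a::field \<times> 'a) set \<Rightarrow> ('a \<times> 'a) set) set" where
  "PGammaL2 = {(\<lambda>P\<in>PG1. \<phi> ` P) | \<phi>. \<phi> \<in> GammaL2}"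

definition PGammaL_equivalent :: "('a::field \<times> 'a) set set \<Rightarrow> ('a \<times> 'a) set set \<Rightarrow> bool" where
  "PGammaL_equivalent L L' \<longleftrightarrow> (\<exists>\<Phi>\<in>PGammaL2. \<Phi> ` L = L')"

subsection \<open>Linear sets\<close>

definition U_set :: "('a::field \<Rightarrow> 'a) \<Rightarrow> ('a \<times> 'a) set" where
  "U_set f = {(x, f x) | x. True}"

definition linear_set :: "('a::field \<Rightarrow> 'a) \<Rightarrow> ('a \<times> 'a) set set" where
  "linear_set f = {plane.span {u} | u. u \<in> U_set f - {0}}"

definition maximum_scattered :: "nat \<Rightarrow> ('a::field \<times> 'a) set set \<Rightarrow> bool" where
  "maximum_scattered q L \<longleftrightarrow> card L = (q ^ 6 - 1) div (q - 1)"

text \<open>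
  In a field of order \<open>q^6\<close>, the unique subfield of order \<open>q\<close> is the fixed field of \<open>x \<mapsto> x^q\<close>.
\<close>

definition subfield_of_order :: "nat \<Rightarrow> 'a::field set" where
  "subfield_of_order q = {x. x ^ q = x}"

text \<open>
  The norm from the field of order \<open>q^6\<close> to its subfield of order \<open>q^e\<close>, for \<open>e\<close> dividing 6:
  the product of the conjugates under the Galois group, which is generated by \<open>x \<mapsto> x^(q^e)\<close>.
\<close>

definition ff_norm :: "nat \<Rightarrow> nat \<Rightarrow> 'a::field \<Rightarrow> 'a" where
  "ff_norm q e \<delta> = (\<Prod>i<6 div e. \<delta> ^ (q ^ (e * i)))"

definition L_h :: "nat \<Rightarrow> 'a::field \<Rightarrow> ('a \<times> 'a) set set" where
  "L_h q h = linear_set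
     (\<lambda>x. h ^ (q - 1) * x ^ q - h ^ (q ^ 2 - 1) * x ^ (q ^ 2) + x ^ (q ^ 4) + x ^ (q ^ 5))"

definition L1 :: "nat \<Rightarrow> ('a::field \<times> 'a) set set" where
  "L1 q = linear_set (\<lambda>x. x ^ q)"

definition L2 :: "nat \<Rightarrow> 'a::field \<Rightarrow> ('a \<times> 'a) set set" where
  "L2 q \<delta> = linear_set (\<lambda>x. \<delta> * x ^ q + x ^ (q ^ 5))"

definition L3 :: "nat \<Rightarrow> 'a::field \<Rightarrow> ('a \<times> 'a) set set" where
  "L3 q \<delta> = linear_set (\<lambda>x. x ^ q + \<delta> * x ^ (q ^ 4))"

definition L4 :: "nat \<Rightarrow> 'a::field \<Rightarrow> ('a \<times> 'a) set set" where
  "L4 q \<delta> = linear_set (\<lambda>x. x ^ q + x ^ (q ^ 3) + \<delta> * x ^ (q ^ 5))"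

end

theory Submission
  imports Defs "HOL-Number_Theory.Cong" "HOL-Computational_Algebra.Polynomial"
    "HOL-Combinatorics.Cycles"
begin

text \<open>
  Why the theorem holds. A linear set \<open>L_f\<close> is determined by its set of slopes \<open>f u / u\<close>. Each slope is
  attained by \<open>q ^ w - 1\<close> vectors for some \<open>w \<ge> 1\<close>, that is, \<open>- 1\<close> times modulo the characteristic, so for every
  \<open>d\<close> the power sum of \<open>(f u / u) ^ d\<close> over all nonzero \<open>u\<close> depends on \<open>L_f\<close> only. When \<open>d\<close> is a sum of
  distinct powers \<open>q ^ i\<close>, \<open>i \<in> D\<close>, expanding the \<open>d\<close>-th power shows that this power sum is, up to sign, the
  permanent of a minor of the Dickson matrix of \<open>f\<close> (lemma \<open>power_sum_qpoly\<close>). Equal linear sets thus have equal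
  permanents, for instance \<open>a 1 * a 5 ^ q\<close>, \<open>a 2 * a 4 ^ (q ^ 2)\<close> and \<open>a 3 ^ (q ^ 3 + 1)\<close>, when \<open>a\<close> lists
  the coefficients and \<open>a 0 = 0\<close>.

  Suppose that \<open>L_h\<close> is equivalent to \<open>L_g\<close>, with \<open>g\<close> from one of the four families. The field
  automorphism is absorbed by replacing \<open>h\<close> with its image. What remains is a matrix: it sends \<open>(u, f_h u)\<close> to
  \<open>(A u, B u)\<close> with \<open>A = t u + e f_h u\<close> and \<open>B = c u + d f_h u\<close>. Since \<open>A\<close> is bijective, \<open>B = a \<circ> A\<close> for a
  linearized polynomial \<open>a\<close> with the same linear set as \<open>g\<close> (lemma \<open>equivalence_normal_form\<close>). The permanents
  of \<open>a\<close> and \<open>g\<close> agree, which prescribes where the coefficients of \<open>a\<close> vanish, and comparing coefficients in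
  \<open>B = a \<circ> A\<close> gives equations over the field (lemma \<open>coefficient_equations\<close>). Their constants are rational in
  \<open>x = h\<close>, \<open>y = h ^ q\<close> and \<open>z = h ^ (q ^ 2)\<close>, because \<open>h ^ (q ^ 3) = - 1 / h\<close>.

  For the first three families \<open>a\<close> has at most two terms, and the equations without \<open>t\<close> force one of \<open>x\<^sup>2 = 1\<close>,
  \<open>x + y = 0\<close> and \<open>x * z = 1\<close>, unless these terms vanish. Each of these makes \<open>h\<close> a square root of 1, which contradicts
  \<open>h ^ (q ^ 3 + 1) = - 1\<close> for odd \<open>q\<close>. For the fourth family \<open>a = A u ^ q + B u ^ (q ^ 3) + C u ^ (q ^ 5)\<close>, and the
  equations determine \<open>t\<close> up to sign. Together with the permanents they imply \<open>h ^ (q ^ 2) = h\<close> and leave two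
  candidates: \<open>h\<^sup>2 = \<delta>\<^sup>2\<close> with \<open>\<delta>\<close> outside the field of order \<open>q\<close>, which the permanent for \<open>D = {0, 1, 2, 3}\<close>
  rules out, and \<open>h\<^sup>2 = - 1\<close>, \<open>\<delta> = 2\<close>. The latter satisfies \<open>\<delta>\<^sup>2 + \<delta> = 1\<close> only in characteristic 5, where it
  puts \<open>h\<close> into the field of order \<open>q\<close>: this is the excluded case (lemma \<open>support_135_forces_char_5\<close>).
\<close>

section \<open>Finite fields of order \<open>q ^ 6\<close>\<close>

text \<open>
  Translating by \<open>w\<close> permutes \<open>K\<close> but changes the sum of its elements by \<open>card K\<close> times \<open>w\<close>.
\<close>

lemma of_nat_card_additive_subgroup:
  fixes K :: "'a::{field, finite} set"
  assumes "\<And>u v. u \<in> K \<Longrightarrow> v \<in> K \<Longrightarrow> u + v \<in> K"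
    and "w \<in> K" "w \<noteq> 0"
  shows "of_nat (card K) = (0::'a)"
proof -
  have "inj_on (\<lambda>u. u + w) K" by (simp add: inj_on_def)
  moreover have "(\<lambda>u. u + w) ` K \<subseteq> K" using assms(1,2) by auto
  ultimately have "(\<lambda>u. u + w) ` K = K" by (intro endo_inj_surj) auto
  then have "(\<Sum>u\<in>K. u) = (\<Sum>u\<in>K. u + w)"
    using sum.reindex[OF \<open>inj_on (\<lambda>u. u + w) K\<close>, of "\<lambda>u. u"] by simp
  also have "\<dots> = (\<Sum>u\<in>K. u) + of_nat (card K) * w"
    by (simp add: sum.distrib)
  finally show ?thesis using \<open>w \<noteq> 0\<close> by simp
qed

text \<open>
  The parameter \<open>F\<close> only names the type, so that the locale can be interpreted without mentioning
  an element of the field.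
\<close>

locale sextic_field =
  fixes q :: nat and F :: "'a::{field, finite} itself"
  assumes q_primepow: "primepow q"
    and q_odd: "odd q"
    and card_field: "CARD('a) = q ^ 6"
begin

lemma q_ge_3: "3 \<le> q"
proof -
  have "q \<noteq> 0" "q \<noteq> 1" "q \<noteq> 2" using primepow_gt_Suc_0[OF q_primepow] q_odd by auto
  then show ?thesis by linarith
qed

lemma q_pos [simp]: "0 < q"
  using q_ge_3 by simp

lemma order_pos: "0 < q ^ 6 - (1::nat)"
  using one_less_power[of q 6] q_ge_3 by simp

lemma char_power: obtains k where "prime CHAR('a)" "0 < k" "q = CHAR('a) ^ k"
proof -
  obtain p k where pk: "prime p" "0 < k" "q = p ^ k"
    using q_primepow by (auto simp: primepow_def)
  have pr: "prime CHAR('a)"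
    by (intro prime_CHAR_semidom finite_imp_CHAR_pos finite)
  have "of_nat CARD('a) = (0::'a)"
    using of_nat_card_additive_subgroup[of "UNIV :: 'a set" 1] by simp
  then have "CHAR('a) dvd p ^ (k * 6)"
    using card_field pk by (simp only: of_nat_eq_0_iff_char_dvd power_mult)
  then have "CHAR('a) dvd p" using pr prime_dvd_power by blast
  then have "CHAR('a) = p" using pr pk primes_dvd_imp_eq by blast
  then show ?thesis using that pk pr by blast
qed

lemma two_neq_0: "(2::'a) \<noteq> 0"
proof
  assume "(2::'a) = 0"
  then have "of_nat 2 = (0::'a)" by simp
  then have "CHAR('a) dvd 2" by (simp only: of_nat_eq_0_iff_char_dvd)
  moreover obtain k where "prime CHAR('a)" "0 < k" "q = CHAR('a) ^ k" by (rule char_power)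
  ultimately have "CHAR('a) = 2" by (meson primes_dvd_imp_eq two_is_prime_nat)
  with \<open>q = CHAR('a) ^ k\<close> \<open>0 < k\<close> q_odd show False by simp
qed

lemma frob_add: "(u + v :: 'a) ^ (q ^ i) = u ^ (q ^ i) + v ^ (q ^ i)"
proof -
  obtain k where "prime CHAR('a)" "0 < k" "q = CHAR('a) ^ k" by (rule char_power)
  then show ?thesis
    by (intro freshmans_dream'[where n = "k * i"]) (simp_all add: power_mult)
qed

lemma frob_sum: "(\<Sum>j\<in>J. u j :: 'a) ^ (q ^ i) = (\<Sum>j\<in>J. u j ^ (q ^ i))"
proof -
  obtain k where "prime CHAR('a)" "0 < k" "q = CHAR('a) ^ k" by (rule char_power)
  then show ?thesis
    by (intro freshmans_dream_sum'[where n = "k * i"]) (simp_all add: power_mult)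
qed

lemma frob_minus: "(- u :: 'a) ^ (q ^ i) = - (u ^ (q ^ i))"
  using q_odd by simp

lemma frob_diff: "(u - v :: 'a) ^ (q ^ i) = u ^ (q ^ i) - v ^ (q ^ i)"
  using frob_add[of u "- v" i] by (simp only: frob_minus) simp

lemma frob_add1: "(u + v :: 'a) ^ q = u ^ q + v ^ q"
  and frob_diff1: "(u - v :: 'a) ^ q = u ^ q - v ^ q"
  using frob_add[of u v 1] frob_diff[of u v 1] by simp_all

lemma frob_eq_0_iff [simp]: "(u :: 'a) ^ (q ^ i) = 0 \<longleftrightarrow> u = 0"
  using q_ge_3 by simp

lemma power_order: "(u::'a) \<noteq> 0 \<Longrightarrow> u ^ (q ^ 6 - 1) = 1"
proof -
  assume u: "u \<noteq> 0"
  have "bij_betw ((*) u) (- {0}) (- {0})"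
    using u by (intro bij_betw_byWitness[where f' = "\<lambda>v. v / u"]) auto
  then have "(\<Prod>v\<in>- {0}. v) = (\<Prod>v\<in>- {0}. u * v)"
    using prod.reindex_bij_betw[of "(*) u" _ _ "\<lambda>v. v"] by simp
  also have "\<dots> = u ^ card (- {0::'a}) * (\<Prod>v\<in>- {0}. v)"
    by (simp add: prod.distrib)
  finally have "u ^ card (- {0::'a}) = 1"
    by (simp add: prod_zero_iff)
  moreover have "card (- {0::'a}) = q ^ 6 - 1"
    by (simp add: Compl_eq_Diff_UNIV card_Diff_singleton card_field)
  ultimately show ?thesis by simp
qed

lemma frob_6: "(u::'a) ^ (q ^ 6) = u"
proof (cases "u = 0")
  case False
  have "q ^ 6 = Suc (q ^ 6 - 1)" using order_pos by linarith
  then have "u ^ (q ^ 6) = u ^ (q ^ 6 - 1) * u" by (metis power_Suc2)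
  then show ?thesis using False power_order by simp
qed (use q_ge_3 in simp)

lemma frob_mod_6: "(u::'a) ^ (q ^ (i mod 6)) = u ^ (q ^ i)"
proof -
  have "u ^ (q ^ (6 * m)) = u" for m
    by (induction m) (simp_all add: frob_6 power_add power_mult)
  from this[of "i div 6"] have "u ^ (q ^ (6 * (i div 6) + i mod 6)) = u ^ (q ^ (i mod 6))"
    by (simp only: power_add power_mult)
  then show ?thesis by simp
qed

lemma exists_power_neq_1:
  assumes "\<not> (q ^ 6 - 1) dvd m"
  obtains u :: 'a where "u \<noteq> 0" "u ^ m \<noteq> 1"
proof -
  define r where "r = m mod (q ^ 6 - 1)"
  have r: "0 < r" "r < q ^ 6 - 1"
    using assms order_pos by (auto simp: r_def mod_eq_0_iff_dvd intro!: Nat.gr0I)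
  have "monom 1 r - 1 \<noteq> (0 :: 'a poly)" "degree (monom 1 r - 1 :: 'a poly) \<le> r"
    using r(1) by (auto simp: poly_eq_iff intro!: exI[of _ r] degree_diff_le degree_monom_le)
  then have "card {u::'a. poly (monom 1 r - 1) u = 0} \<le> r"
    using card_poly_roots_bound le_trans by blast
  then have "card {u::'a. u ^ r = 1} \<le> r" by (simp add: poly_monom)
  then have "card {u::'a. u ^ r = 1} < card (- {0::'a})"
    using r(2) by (simp add: Compl_eq_Diff_UNIV card_Diff_singleton card_field)
  then have "\<not> - {0::'a} \<subseteq> {u. u ^ r = 1}"
    by (metis card_mono finite not_less)
  then obtain u :: 'a where u: "u \<noteq> 0" "u ^ r \<noteq> 1" by auto
  have "u ^ m = u ^ ((q ^ 6 - 1) * (m div (q ^ 6 - 1)) + r)"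
    by (simp only: r_def mult_div_mod_eq)
  also have "\<dots> = u ^ r"
    by (simp only: power_add power_mult power_order[OF u(1)] power_one mult_1)
  finally show ?thesis using that u by simp
qed

text \<open>
  The orthogonality relation behind all power sums: multiplying the summation variable by some \<open>w\<close>
  scales the sum by \<open>w ^ (m - n)\<close>, which can be chosen different from 1 exactly when
  \<open>q ^ 6 - 1\<close> does not divide \<open>m - n\<close>.
\<close>

lemma sum_power_quotient:
  "(\<Sum>u\<in>- {0::'a}. u ^ m / u ^ n) = (if [m = n] (mod q ^ 6 - 1) then - 1 else 0)"
proof -
  have *: "(\<Sum>u\<in>- {0::'a}. u ^ m / u ^ n) = (if [m = n] (mod q ^ 6 - 1) then - 1 else 0)"
    if "n \<le> m" for m n
  proof -
    have quot: "u ^ m / u ^ n = u ^ (m - n)" if "u \<noteq> 0" for u :: 'a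
      using that \<open>n \<le> m\<close> by (simp add: power_diff)
    show ?thesis
    proof (cases "(q ^ 6 - 1) dvd (m - n)")
      case True
      then obtain l where l: "m - n = (q ^ 6 - 1) * l" by blast
      have "(\<Sum>u\<in>- {0::'a}. u ^ m / u ^ n) = (\<Sum>u\<in>- {0::'a}. 1)"
      proof (intro sum.cong refl)
        fix u :: 'a assume "u \<in> - {0}"
        then have u: "u \<noteq> 0" by simp
        show "u ^ m / u ^ n = 1"
          unfolding quot[OF u] l power_mult power_order[OF u] by (rule power_one)
      qed
      also have "\<dots> = of_nat (card (- {0::'a}))" by simp
      also have "\<dots> = - 1"
      proof -
        have "of_nat CARD('a) = (0::'a)"
          using of_nat_card_additive_subgroup[of "UNIV :: 'a set" 1] by simp
        moreover have "CARD('a) = Suc (card (- {0::'a}))"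
          by (metis Compl_eq_Diff_UNIV card_Suc_Diff1 finite iso_tuple_UNIV_I)
        ultimately show ?thesis by (metis add.commute eq_neg_iff_add_eq_0 of_nat_Suc)
      qed
      finally show ?thesis using True cong_altdef_nat[OF that] by simp
    next
      case False
      obtain w :: 'a where w: "w \<noteq> 0" "w ^ (m - n) \<noteq> 1"
        using exists_power_neq_1[OF False] by blast
      have bij: "bij_betw ((*) w) (- {0}) (- {0})"
        using w by (intro bij_betw_byWitness[where f' = "\<lambda>v. v / w"]) auto
      have "(\<Sum>u\<in>- {0::'a}. u ^ (m - n)) = (\<Sum>u\<in>- {0::'a}. (w * u) ^ (m - n))"
        using sum.reindex_bij_betw[OF bij, of "\<lambda>u. u ^ (m - n)"] by simp
      also have "\<dots> = w ^ (m - n) * (\<Sum>u\<in>- {0::'a}. u ^ (m - n))"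
        by (simp add: power_mult_distrib sum_distrib_left)
      finally have "(\<Sum>u\<in>- {0::'a}. u ^ (m - n)) = 0" using w by simp
      moreover have "(\<Sum>u\<in>- {0::'a}. u ^ m / u ^ n) = (\<Sum>u\<in>- {0::'a}. u ^ (m - n))"
        by (intro sum.cong refl quot) simp
      ultimately show ?thesis using False cong_altdef_nat[OF that] by simp
    qed
  qed
  show ?thesis
  proof (cases "n \<le> m")
    case False
    have "bij_betw inverse (- {0::'a}) (- {0})"
      by (intro bij_betw_byWitness[where f' = inverse]) auto
    from sum.reindex_bij_betw[OF this, of "\<lambda>u. u ^ m / u ^ n"]
    have "(\<Sum>u\<in>- {0::'a}. u ^ m / u ^ n) = (\<Sum>u\<in>- {0::'a}. u ^ n / u ^ m)"
      by (simp add: field_simps)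
    then show ?thesis using *[of m n] False using cong_sym_eq[of m n] by simp
  qed (rule *)
qed

end

section \<open>Sums of distinct powers of \<open>q\<close> modulo \<open>q ^ n - 1\<close>\<close>

lemma radix_bound:
  fixes q :: nat
  assumes "\<And>j. j < n \<Longrightarrow> c j < q"
  shows "(\<Sum>j<n. c j * q ^ j) < q ^ n"
  using assms
proof (induction n)
  case (Suc n)
  have "(\<Sum>j<n. c j * q ^ j) < q ^ n" using Suc by simp
  moreover have "(c n + 1) * q ^ n \<le> q * q ^ n"
    using Suc.prems[of n] by (intro mult_right_mono) auto
  ultimately show ?case by (simp add: algebra_simps)
qed simp

lemma radix_unique:
  fixes q :: nat
  assumes "\<And>j. j < n \<Longrightarrow> c j < q" "\<And>j. j < n \<Longrightarrow> e j < q"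
    and "(\<Sum>j<n. c j * q ^ j) = (\<Sum>j<n. e j * q ^ j)" "j < n"
  shows "c j = e j"
  using assms
proof (induction n)
  case (Suc n)
  have b: "(\<Sum>j<n. c j * q ^ j) < q ^ n" "(\<Sum>j<n. e j * q ^ j) < q ^ n"
    using Suc.prems by (auto intro!: radix_bound)
  have q: "q ^ n > 0" using b by (metis gr0I not_less_zero)
  have "c n = ((\<Sum>j<n. c j * q ^ j) + c n * q ^ n) div q ^ n"
    using b q by simp
  also have "\<dots> = ((\<Sum>j<n. e j * q ^ j) + e n * q ^ n) div q ^ n"
    using Suc.prems(3) by simp
  also have "\<dots> = e n" using b q by simp
  finally have "c n = e n" .
  then show ?case using Suc by (cases "j = n") auto
qed simp

text \<open>
  A nonzero number whose base-\<open>q\<close> digits are 0 or 1 is already reduced modulo \<open>q ^ n - 1\<close>. Any other digit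
  vector \<open>c\<close> for the same residue has some digit at least \<open>q\<close>, and a cyclic carry replaces it by a
  vector for the same residue whose digit sum is smaller by \<open>q - 1\<close>; so the digit sum of a reduced
  vector is the strict minimum.
\<close>

lemma digit_sum_minimal:
  fixes q n :: nat
  assumes "3 \<le> q" "0 < n"
    and "\<And>j. e j \<le> 1" "\<exists>j<n. e j \<noteq> 0"
    and "[(\<Sum>j<n. c j * q ^ j) = (\<Sum>j<n. e j * q ^ j)] (mod q ^ n - 1)"
  shows "(\<Sum>j<n. e j) \<le> (\<Sum>j<n. c j) \<and> ((\<Sum>j<n. e j) = (\<Sum>j<n. c j) \<longrightarrow> (\<forall>j<n. c j = e j))"
  using assms(5)
proof (induction "\<Sum>j<n. c j" arbitrary: c rule: less_induct)
  case less
  show ?case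
  proof (cases "\<forall>j<n. c j < q")
    case True
    have "(\<Sum>j<n. e j * q ^ j) \<le> (\<Sum>j<n. 1 * q ^ j)"
      using assms(3) by (intro sum_mono mult_right_mono) auto
    moreover have "(\<Sum>j<n. 2 * q ^ j) < q ^ n"
      using assms(1) by (intro radix_bound) auto
    moreover have "(\<Sum>j<n. 2 * q ^ j) = 2 * (\<Sum>j<n. 1 * q ^ j)" by (simp add: sum_distrib_left)
    moreover have pos: "0 < (\<Sum>j<n. e j * q ^ j)"
      using assms(1,4) by (intro sum_pos2[of _ "SOME j. j < n \<and> e j \<noteq> 0"])
        (auto dest!: someI_ex)
    \<comment> \<open>Even twice the sum of all powers is below \<open>q ^ n\<close>; this is where \<open>q\<close> must exceed 2.\<close>
    ultimately have e: "(\<Sum>j<n. e j * q ^ j) < q ^ n - 1" by linarith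
    have c: "(\<Sum>j<n. c j * q ^ j) \<le> q ^ n - 1" using radix_bound[of n c q] True by simp
    have "(\<Sum>j<n. c j * q ^ j) = (\<Sum>j<n. e j * q ^ j)"
    proof (cases "(\<Sum>j<n. c j * q ^ j) = q ^ n - 1")
      case True
      then have "(\<Sum>j<n. e j * q ^ j) mod (q ^ n - 1) = 0"
        using less.prems by (simp only: cong_def mod_self)
      then have False using e pos by (simp only: mod_less)
      then show ?thesis ..
    next
      case False
      then show ?thesis using less.prems c e by (simp add: cong_def)
    qed
    moreover have "e j < q" for j using assms(1) assms(3)[of j] by linarith
    ultimately have "\<forall>j<n. c j = e j" using radix_unique[of n c q e] True by blast
    then show ?thesis by simp
  next
    case False
    then obtain j where j: "j < n" "q \<le> c j" by (auto simp: not_less)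
    define k where "k = Suc j mod n"
    have k: "k < n" using assms(2) by (simp add: k_def)
    \<comment> \<open>Carry: \<open>q\<close> units of digit \<open>j\<close> become one unit of the next digit, cyclically since \<open>q ^ n\<close> is congruent to 1.\<close>
    define c0 where "c0 = c(j := c j - q)"
    define c' where "c' = c0(k := c0 k + 1)"
    have S: "(\<Sum>i<n. c i * w i) = (\<Sum>i<n. c0 i * w i) + q * w j"
      and S': "(\<Sum>i<n. c' i * w i) = (\<Sum>i<n. c0 i * w i) + w k" for w
    proof -
      have *: "(\<Sum>i<n. f i) = f l + (\<Sum>i\<in>{..<n}-{l}. f i)" if "l < n" for l and f :: "nat \<Rightarrow> nat"
        using that by (simp add: sum.remove)
      show "(\<Sum>i<n. c i * w i) = (\<Sum>i<n. c0 i * w i) + q * w j"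
      proof -
        have "c j * w j = (c j - q) * w j + q * w j"
          using j(2) by (simp flip: add_mult_distrib)
        then show ?thesis by (subst (1 2) *[OF j(1)]) (simp add: c0_def)
      qed
      show "(\<Sum>i<n. c' i * w i) = (\<Sum>i<n. c0 i * w i) + w k"
        by (subst (1 2) *[OF k]) (simp add: c'_def algebra_simps)
    qed
    have "[q ^ k = q * q ^ j] (mod q ^ n - 1)"
    proof (cases "Suc j = n")
      case True
      then have "[q * q ^ j = 1] (mod q ^ n - 1)"
        using assms(1) by (simp add: cong_altdef_nat flip: power_Suc)
      then show ?thesis using True by (simp add: k_def cong_sym_eq)
    next
      case False
      then show ?thesis using j by (simp add: k_def)
    qed
    then have "[(\<Sum>i<n. c' i * q ^ i) = (\<Sum>i<n. c i * q ^ i)] (mod q ^ n - 1)"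
      unfolding S S' by (intro cong_add cong_refl)
    then have "[(\<Sum>i<n. c' i * q ^ i) = (\<Sum>i<n. e i * q ^ i)] (mod q ^ n - 1)"
      using less.prems cong_trans by blast
    moreover have lt: "(\<Sum>i<n. c' i) < (\<Sum>i<n. c i)"
      using S[of "\<lambda>_. 1"] S'[of "\<lambda>_. 1"] assms(1) by simp
    ultimately show ?thesis using less.hyps[of c'] by linarith
  qed
qed

text \<open>
  The multiplicities of the values of \<open>\<tau>\<close> are digits with the same digit sum as the indicator of \<open>D\<close>,
  so minimality of that digit sum forces them to be equal.
\<close>

lemma sum_powers_cong_imp_image_eq:
  fixes q n :: nat
  assumes "3 \<le> q" "D \<subseteq> {..<n}" "D \<noteq> {}" "\<tau> ` D \<subseteq> {..<n}"
    and "[(\<Sum>i\<in>D. q ^ \<tau> i) = (\<Sum>i\<in>D. q ^ i)] (mod q ^ n - 1)"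
  shows "\<tau> ` D = D"
proof -
  have fin: "finite D" using assms(2) finite_subset by blast
  define c where "c j = card {i \<in> D. \<tau> i = j}" for j
  define e :: "nat \<Rightarrow> nat" where "e j = (if j \<in> D then 1 else 0)" for j
  have C: "(\<Sum>i\<in>D. w (\<tau> i)) = (\<Sum>j<n. c j * w j)" for w :: "nat \<Rightarrow> nat"
    using sum.group[OF fin finite_lessThan assms(4), of "\<lambda>i. w (\<tau> i)"]
    by (simp add: c_def)
  have E: "(\<Sum>i\<in>D. w i) = (\<Sum>j<n. e j * w j)" for w :: "nat \<Rightarrow> nat"
  proof -
    have "(\<Sum>j<n. e j * w j) = (\<Sum>j\<in>D. e j * w j)"
      using assms(2) by (intro sum.mono_neutral_right) (auto simp: e_def)
    then show ?thesis by (simp add: e_def)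
  qed
  have "n > 0" using assms(2,3) by auto
  moreover have "(\<Sum>j<n. e j) = (\<Sum>j<n. c j)"
    using C[of "\<lambda>_. 1"] E[of "\<lambda>_. 1"] by simp
  moreover have "\<exists>j<n. e j \<noteq> 0" using assms(2,3) by (auto simp: e_def)
  moreover have "e j \<le> 1" for j by (simp add: e_def)
  ultimately have eq: "\<forall>j<n. c j = e j"
    using digit_sum_minimal[of q n e c] assms(1,5) unfolding C[of "\<lambda>j. q ^ j"] E[of "\<lambda>j. q ^ j"]
    by blast
  have "\<tau> ` D \<subseteq> D"
  proof
    fix j assume j: "j \<in> \<tau> ` D"
    then have "c j \<noteq> 0" using fin by (auto simp: c_def)
    moreover have "j < n" using j assms(4) by auto
    ultimately have "e j \<noteq> 0" using eq by auto
    then show "j \<in> D" by (simp add: e_def split: if_splits)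
  qed
  moreover have "D \<subseteq> \<tau> ` D"
  proof
    fix j assume j: "j \<in> D"
    then have "c j = 1" using eq assms(2) by (auto simp: e_def)
    then have "{i \<in> D. \<tau> i = j} \<noteq> {}" unfolding c_def by (metis card.empty zero_neq_one)
    then show "j \<in> \<tau> ` D" by auto
  qed
  ultimately show ?thesis by blast
qed

section \<open>Linearized polynomials and their power sums\<close>

lemma sum_upto_6: "(\<Sum>i<6. f i) = f 0 + f 1 + f 2 + f 3 + f 4 + f (5::nat)"
  for f :: "nat \<Rightarrow> 'b::comm_monoid_add"
  by (simp add: eval_nat_numeral)

text \<open>
  Written with an explicit \<open>f\<close>, so that the 24 terms can be evaluated by rewriting the arguments
  only.
\<close>

lemma sum_permutations_4:
  fixes f :: "nat \<Rightarrow> nat \<Rightarrow> nat \<Rightarrow> nat \<Rightarrow> 'b::comm_monoid_add"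
  shows "(\<Sum>p | p permutes {0, 1, 2, 3}. f (p 0) (p 1) (p 2) (p 3)) =
    (\<Sum>b\<in>{0,1,2,3}. \<Sum>c\<in>{1,2,3}. \<Sum>d\<in>{2,3}.
      f (Transposition.transpose 0 b (Transposition.transpose 1 c (Transposition.transpose 2 d 0)))
        (Transposition.transpose 0 b (Transposition.transpose 1 c (Transposition.transpose 2 d 1)))
        (Transposition.transpose 0 b (Transposition.transpose 1 c (Transposition.transpose 2 d 2)))
        (Transposition.transpose 0 b (Transposition.transpose 1 c (Transposition.transpose 2 d 3))))"
proof -
  have f: "finite {1, 2, 3::nat}" "0 \<notin> {1, 2, 3::nat}" "finite {2, 3::nat}" "1 \<notin> {2, 3::nat}"
    "finite {3::nat}" "2 \<notin> {3::nat}" by simp_all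
  show ?thesis
    unfolding sum_over_permutations_insert[OF f(1,2)] sum_over_permutations_insert[OF f(3,4)]
      sum_over_permutations_insert[OF f(5,6)] permutes_sing
    by (simp only: singleton_conv sum.insert_if finite.emptyI finite_insert sum.empty o_apply
        id_apply empty_iff if_False add_0_right)
qed

context sextic_field
begin

definition qpoly :: "(nat \<Rightarrow> 'a) \<Rightarrow> 'a \<Rightarrow> 'a" where
  "qpoly a u = (\<Sum>j<6. a j * u ^ (q ^ j))"

text \<open>
  Coefficients of the composition of two \<open>q\<close>-polynomials. Exponents are taken modulo 6, because
  \<open>u ^ (q ^ 6) = u\<close>; the summand \<open>6\<close> keeps the subtraction of naturals from truncating.
\<close>

definition qcomp :: "(nat \<Rightarrow> 'a) \<Rightarrow> (nat \<Rightarrow> 'a) \<Rightarrow> nat \<Rightarrow> 'a" where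
  "qcomp a b k = (\<Sum>i<6. a i * b ((k + 6 - i) mod 6) ^ (q ^ i))"

lemma qpoly_add: "qpoly a (u + v) = qpoly a u + qpoly a v"
  by (simp add: qpoly_def frob_add algebra_simps sum.distrib)

lemma frob_zero: "(0::'a) ^ (q ^ i) = 0"
  and frob_zero1: "(0::'a) ^ q = 0"
  using q_ge_3 by simp_all

lemma qpoly_0 [simp]: "qpoly a 0 = 0"
  by (simp add: qpoly_def frob_zero)

lemma bij_betw_add_mod:
  assumes "i < (n::nat)"
  shows "bij_betw (\<lambda>k. (k + n - i) mod n) {..<n} {..<n}"
  by (rule bij_betw_byWitness[where f' = "\<lambda>k. (k + i) mod n"])
     (use assms in \<open>auto simp: mod_if\<close>)

lemma qpoly_frob:
  assumes "i < 6"
  shows "qpoly b u ^ (q ^ i) = (\<Sum>k<6. b ((k + 6 - i) mod 6) ^ (q ^ i) * u ^ (q ^ k))"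
proof -
  have "qpoly b u ^ (q ^ i) = (\<Sum>j<6. b j ^ (q ^ i) * u ^ (q ^ (j + i)))"
    by (simp add: qpoly_def frob_sum power_mult_distrib power_add power_mult)
  also have "\<dots> = (\<Sum>k<6. b ((k + 6 - i) mod 6) ^ (q ^ i) * u ^ (q ^ ((k + 6 - i) mod 6 + i)))"
    by (rule sum.reindex_bij_betw[OF bij_betw_add_mod[OF assms], symmetric])
  also have "\<dots> = (\<Sum>k<6. b ((k + 6 - i) mod 6) ^ (q ^ i) * u ^ (q ^ k))"
  proof (intro sum.cong refl)
    fix k :: nat assume "k \<in> {..<6}"
    then have "((k + 6 - i) mod 6 + i) mod 6 = k"
      using assms by (simp add: mod_add_left_eq)
    then show "b ((k + 6 - i) mod 6) ^ (q ^ i) * u ^ (q ^ ((k + 6 - i) mod 6 + i))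
        = b ((k + 6 - i) mod 6) ^ (q ^ i) * u ^ (q ^ k)"
      using frob_mod_6[of u "(k + 6 - i) mod 6 + i"] by simp
  qed
  finally show ?thesis .
qed

lemma qpoly_qcomp: "qpoly a (qpoly b u) = qpoly (qcomp a b) u"
proof -
  have "qpoly a (qpoly b u)
      = (\<Sum>i<6. \<Sum>k<6. a i * b ((k + 6 - i) mod 6) ^ (q ^ i) * u ^ (q ^ k))"
    by (simp add: qpoly_def[of a] qpoly_frob sum_distrib_left mult.assoc)
  also have "\<dots> = (\<Sum>k<6. \<Sum>i<6. a i * b ((k + 6 - i) mod 6) ^ (q ^ i) * u ^ (q ^ k))"
    by (rule sum.swap)
  finally show ?thesis by (simp add: qpoly_def qcomp_def sum_distrib_right)
qed

text \<open>
  A \<open>q\<close>-polynomial has degree at most \<open>q ^ 5\<close>, too small for \<open>q ^ 6\<close> roots unless it is zero.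
\<close>

lemma qpoly_eq_0_imp:
  assumes "\<And>u. qpoly a u = 0" "j < 6"
  shows "a j = 0"
proof (rule ccontr)
  assume "a j \<noteq> 0"
  define P where "P = (\<Sum>i<6. monom (a i) (q ^ i))"
  have inj: "q ^ i = q ^ l \<longleftrightarrow> i = l" for i l
    using q_ge_3 by simp
  have "coeff P (q ^ j) = a j"
    using \<open>j < 6\<close> by (simp add: P_def coeff_sum inj)
  then have "P \<noteq> 0" using \<open>a j \<noteq> 0\<close> by auto
  have "degree P \<le> q ^ 5"
    unfolding P_def
  proof (intro degree_sum_le)
    fix i :: nat assume "i \<in> {..<6}"
    then have "q ^ i \<le> q ^ 5" using q_ge_3 by (intro power_increasing) auto
    then show "degree (monom (a i) (q ^ i)) \<le> q ^ 5"
      using degree_monom_le le_trans by blast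
  qed simp
  have "poly P u = 0" for u
    using assms(1)[of u] by (simp add: P_def poly_sum poly_monom qpoly_def)
  then have "{u. poly P u = 0} = UNIV" by auto
  then have "q ^ 6 \<le> degree P"
    using card_poly_roots_bound[OF \<open>P \<noteq> 0\<close>] by (simp flip: card_field)
  then have "q ^ 6 \<le> q ^ 5" using \<open>degree P \<le> q ^ 5\<close> by linarith
  then show False using q_ge_3 power_strict_increasing[of 5 6 q] by simp
qed

lemma qpoly_unique:
  assumes "\<And>u. qpoly a u = qpoly b u" "j < 6"
  shows "a j = b j"
proof -
  have "qpoly (\<lambda>i. a i - b i) u = 0" for u
    using assms(1)[of u] by (simp add: qpoly_def algebra_simps sum_subtractf)
  from qpoly_eq_0_imp[OF this \<open>j < 6\<close>] show ?thesis by simp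
qed

text \<open>
  Polynomials of this form are closed under composition, hence so are the iterates of a bijective
  one.
\<close>

lemma inv_qpoly:
  assumes "\<And>u. qpoly a u = 0 \<Longrightarrow> u = 0"
  obtains b where "\<And>u. qpoly b (qpoly a u) = u" "\<And>u. qpoly a (qpoly b u) = u"
proof -
  have "inj (qpoly a)"
  proof (rule injI)
    fix u v assume "qpoly a u = qpoly a v"
    then have "qpoly a (u - v) = 0"
      using qpoly_add[of a "u - v" v] by simp
    then show "u = v" using assms[of "u - v"] by simp
  qed
  then have perm: "qpoly a permutes UNIV"
    by (intro bij_imp_permutes) (simp_all add: bij_betw_def finite_UNIV_inj_surj)
  \<comment> \<open>The inverse of a permutation of a finite set is one of its iterates.\<close>
  have iter: "\<exists>b. \<forall>u. qpoly b u = (qpoly a ^^ n) u" for n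
  proof (induction n)
    case 0
    have "qpoly (\<lambda>j. if j = 0 then 1 else 0) u = u" for u
      by (simp add: qpoly_def sum_upto_6)
    then show ?case by auto
  next
    case (Suc n)
    then obtain b where "\<forall>u. qpoly b u = (qpoly a ^^ n) u" by blast
    then have "\<forall>u. qpoly (qcomp a b) u = (qpoly a ^^ Suc n) u" by (simp flip: qpoly_qcomp)
    then show ?case by blast
  qed
  obtain n where n: "0 < n" "qpoly a ^^ n = id"
    using permutation_is_nilpotent[OF permutes_imp_permutation[OF finite perm]] by auto
  then obtain m where m: "n = Suc m" using gr0_implies_Suc by blast
  obtain b where b: "\<forall>u. qpoly b u = (qpoly a ^^ m) u" using iter by blast
  show ?thesis
  proof
    fix u
    show "qpoly b (qpoly a u) = u" "qpoly a (qpoly b u) = u"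
      using n(2) b by (auto simp: m fun_eq_iff funpow_swap1)
  qed
qed

text \<open>
  The permanent of the minor, with rows and columns in \<open>D\<close>, of the Dickson matrix of \<open>a\<close>: its row
  \<open>i\<close> lists the coefficients of the \<open>q ^ i\<close>-th power of the polynomial.
\<close>

definition frob_permanent :: "(nat \<Rightarrow> 'a) \<Rightarrow> nat set \<Rightarrow> 'a" where
  "frob_permanent a D = (\<Sum>p | p permutes D. \<Prod>i\<in>D. a ((p i + 6 - i) mod 6) ^ (q ^ i))"

text \<open>
  The power \<open>(qpoly a u) ^ d\<close> with \<open>d = (\<Sum>i\<in>D. q ^ i)\<close> is a product over \<open>D\<close> of Frobenius conjugates
  of the polynomial. Expanding it gives one monomial for each map \<open>\<tau>\<close> that selects a term from
  each factor. After division by \<open>u ^ d\<close> and summation over \<open>u\<close>, orthogonality leaves the \<open>\<tau>\<close>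
  whose exponent is congruent to \<open>d\<close>, and those are the permutations of \<open>D\<close>.
\<close>

lemma power_sum_qpoly:
  assumes "D \<subseteq> {..<6}" "D \<noteq> {}"
  shows "(\<Sum>u\<in>- {0}. (qpoly a u / u) ^ (\<Sum>i\<in>D. q ^ i)) = - frob_permanent a D"
proof -
  define d where "d = (\<Sum>i\<in>D. q ^ i)"
  define M where "M i k = a ((k + 6 - i) mod 6) ^ (q ^ i)" for i k
  have fin: "finite D" using assms(1) finite_subset by blast
  have expand: "(qpoly a u / u) ^ d
      = (\<Sum>\<tau>\<in>D \<rightarrow>\<^sub>E {..<6}. (\<Prod>i\<in>D. M i (\<tau> i)) * (u ^ (\<Sum>i\<in>D. q ^ \<tau> i) / u ^ d))" for u
  proof -
    have "qpoly a u ^ d = (\<Prod>i\<in>D. \<Sum>k<6. M i k * u ^ (q ^ k))"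
      using assms(1) by (auto simp: d_def power_sum M_def qpoly_frob intro!: prod.cong)
    also have "\<dots> = (\<Sum>\<tau>\<in>D \<rightarrow>\<^sub>E {..<6}. \<Prod>i\<in>D. M i (\<tau> i) * u ^ (q ^ \<tau> i))"
      using fin by (intro prod_sum_PiE) auto
    also have "\<dots> = (\<Sum>\<tau>\<in>D \<rightarrow>\<^sub>E {..<6}. (\<Prod>i\<in>D. M i (\<tau> i)) * u ^ (\<Sum>i\<in>D. q ^ \<tau> i))"
      by (simp add: prod.distrib power_sum)
    finally show ?thesis by (simp add: power_divide sum_divide_distrib)
  qed
  have perm_iff: "[(\<Sum>i\<in>D. q ^ \<tau> i) = d] (mod q ^ 6 - 1) \<longleftrightarrow> \<tau> ` D = D"
    if "\<tau> \<in> D \<rightarrow>\<^sub>E {..<6}" for \<tau>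
  proof
    assume "[(\<Sum>i\<in>D. q ^ \<tau> i) = d] (mod q ^ 6 - 1)"
    then show "\<tau> ` D = D"
      using sum_powers_cong_imp_image_eq[OF q_ge_3 assms(1,2), of \<tau>] that by (auto simp: d_def)
  next
    assume "\<tau> ` D = D"
    then have "bij_betw \<tau> D D" using fin by (simp add: bij_betw_def eq_card_imp_inj_on)
    then have "(\<Sum>i\<in>D. q ^ \<tau> i) = d" unfolding d_def by (rule sum.reindex_bij_betw)
    then show "[(\<Sum>i\<in>D. q ^ \<tau> i) = d] (mod q ^ 6 - 1)" by simp
  qed
  have "(\<Sum>u\<in>- {0}. (qpoly a u / u) ^ d)
      = (\<Sum>\<tau>\<in>D \<rightarrow>\<^sub>E {..<6}. (\<Prod>i\<in>D. M i (\<tau> i)) * (\<Sum>u\<in>- {0}. u ^ (\<Sum>i\<in>D. q ^ \<tau> i) / u ^ d))"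
    unfolding expand sum_distrib_left by (rule sum.swap)
  also have "\<dots> = (\<Sum>\<tau>\<in>D \<rightarrow>\<^sub>E {..<6}. if \<tau> ` D = D then - (\<Prod>i\<in>D. M i (\<tau> i)) else 0)"
    unfolding sum_power_quotient by (intro sum.cong refl) (simp add: perm_iff del: One_nat_def)
  also have "\<dots> = (\<Sum>\<tau> | \<tau> \<in> D \<rightarrow>\<^sub>E {..<6} \<and> \<tau> ` D = D. - (\<Prod>i\<in>D. M i (\<tau> i)))"
    using fin by (intro sum.inter_filter[symmetric] finite_PiE) auto
  also have "\<dots> = (\<Sum>p | p permutes D. - (\<Prod>i\<in>D. M i (p i)))"
  proof (rule sum.reindex_bij_witness[where i = "\<lambda>p. restrict p D"
        and j = "\<lambda>\<tau> x. if x \<in> D then \<tau> x else x"])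
    fix \<tau> assume \<tau>: "\<tau> \<in> {\<tau>. \<tau> \<in> D \<rightarrow>\<^sub>E {..<6} \<and> \<tau> ` D = D}"
    then show "restrict (\<lambda>x. if x \<in> D then \<tau> x else x) D = \<tau>"
      by (auto simp: fun_eq_iff restrict_def PiE_def extensional_def)
    have "bij_betw \<tau> D D" using \<tau> fin by (simp add: bij_betw_def eq_card_imp_inj_on)
    then have "bij_betw (\<lambda>x. if x \<in> D then \<tau> x else x) D D"
      by (rule bij_betw_cong[THEN iffD1, rotated]) simp
    then show "(\<lambda>x. if x \<in> D then \<tau> x else x) \<in> {p. p permutes D}"
      by (auto intro!: bij_imp_permutes)
  next
    fix p assume "p \<in> {p. p permutes D}"
    then have p: "p permutes D" by simp
    then show "(\<lambda>x. if x \<in> D then restrict p D x else x) = p"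
      by (auto simp: fun_eq_iff permutes_not_in)
    have "p ` D = D" using p by (rule permutes_image)
    then show "restrict p D \<in> {\<tau>. \<tau> \<in> D \<rightarrow>\<^sub>E {..<6} \<and> \<tau> ` D = D}"
      using assms(1) by auto
  qed (auto intro!: prod.cong)
  finally show ?thesis
    by (simp add: d_def frob_permanent_def M_def sum_negf)
qed

lemma frob_permanent_1: "frob_permanent a {0} = a 0"
  by (simp add: frob_permanent_def permutes_sing)

lemma frob_permanent_2:
  assumes "i < 6" "0 < i" "a 0 = 0"
  shows "frob_permanent a {0, i} = a i * a (6 - i) ^ (q ^ i)"
proof -
  have "frob_permanent a (insert 0 {i}) = a i * a (6 - i) ^ (q ^ i)"
    unfolding frob_permanent_def
    using assms q_ge_3 by (subst sum_over_permutations_insert)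
      (auto simp: permutes_sing Transposition.transpose_def)
  then show ?thesis by simp
qed

text \<open>
  With \<open>a 0 = 0\<close> fixed points do not contribute, which leaves the two 3-cycles.
\<close>

lemma frob_permanent_012:
  assumes "a 0 = 0"
  shows "frob_permanent a {0, 1, 2}
    = a 1 ^ (1 + q) * a 4 ^ (q ^ 2) + a 2 * a 5 ^ (q + q ^ 2)"
  unfolding frob_permanent_def
  by (simp add: sum_over_permutations_insert Transposition.transpose_def assms
      frob_zero frob_zero1 power_add mult_ac)

text \<open>
  Only permutations that move every index by an odd amount contribute: two products of two
  transpositions and two 4-cycles.
\<close>

lemma frob_permanent_0123:
  assumes "a 0 = 0" "a 2 = 0" "a 4 = 0"
  shows "frob_permanent a {0, 1, 2, 3}
    = a 1 * a 5 ^ q * (a 1 * a 5 ^ q) ^ (q ^ 2) + a 3 ^ (1 + q ^ 3) * (a 1 * a 5 ^ q) ^ q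
    + a 1 ^ (1 + q + q ^ 2) * a 3 ^ (q ^ 3) + a 3 * a 5 ^ (q + q ^ 2 + q ^ 3)"
proof -
  have "frob_permanent a {0, 1, 2, 3}
    = a 1 * a 5 ^ q * (a 1 ^ (q ^ 2) * a 5 ^ (q ^ 3)) + a 3 * a 3 ^ (q ^ 3) * (a 1 ^ q * a 5 ^ (q ^ 2))
    + a 1 * a 1 ^ q * a 1 ^ (q ^ 2) * a 3 ^ (q ^ 3) + a 3 * a 5 ^ q * a 5 ^ (q ^ 2) * a 5 ^ (q ^ 3)"
  proof -
    define f where "f j0 j1 j2 j3 = a (j0 mod 6) * (a ((j1 + 5) mod 6) ^ q
      * (a ((j2 + 4) mod 6) ^ (q ^ 2) * a ((j3 + 3) mod 6) ^ (q ^ 3)))" for j0 j1 j2 j3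
    have "frob_permanent a {0, 1, 2, 3}
        = (\<Sum>p | p permutes {0, 1, 2, 3}. f (p 0) (p 1) (p 2) (p 3))"
      by (simp add: frob_permanent_def f_def add.commute)
    then show ?thesis
      unfolding sum_permutations_4 Transposition.transpose_def
      by (simp add: f_def assms frob_zero frob_zero1 algebra_simps
          flip: numeral_2_eq_2 numeral_3_eq_3)
  qed
  moreover have "(u ^ q) ^ q = u ^ (q ^ 2)" "(u ^ q) ^ (q ^ 2) = u ^ (q ^ 3)" for u :: 'a
    by (simp_all add: power2_eq_square power3_eq_cube mult.assoc flip: power_mult)
  ultimately show ?thesis by (simp add: power_add power_mult_distrib)
qed

end

section \<open>Equivalences as compositions of linearized polynomials\<close>

text \<open>
  The affine coordinates of the points of \<open>linear_set f\<close>, which avoids the point at infinity.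
\<close>

definition slopes :: "('a::field \<Rightarrow> 'a) \<Rightarrow> 'a set" where
  "slopes f = (\<lambda>u. f u / u) ` (- {0})"

lemma scale2_0 [simp]: "scale2 (0::'a::field) u = 0"
  by (simp add: scale2_def zero_prod_def)

lemma span_singleton_pair: "plane.span {u :: 'a::field \<times> 'a} = range (\<lambda>c. scale2 c u)"
  by (rule plane.span_singleton)

lemma mem_span_singleton_nonzero:
  assumes "v \<in> plane.span {u :: 'a::field \<times> 'a}" "v \<noteq> 0"
  obtains c where "c \<noteq> 0" "v = scale2 c u"
  using assms unfolding span_singleton_pair by (metis rangeE scale2_0)

lemma linear_set_eq: "f 0 = 0 \<Longrightarrow> linear_set f = (\<lambda>u. plane.span {(u, f u)}) ` (- {0})"
  by (auto simp: linear_set_def U_set_def zero_prod_def)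

lemma GammaL2_coordinates:
  fixes \<phi> :: "'a::field \<times> 'a \<Rightarrow> 'a \<times> 'a"
  assumes "\<phi> \<in> GammaL2"
  obtains \<sigma> a b c d where "field_automorphism \<sigma>" "b \<noteq> 0 \<or> d \<noteq> 0"
    "\<forall>u v. \<phi> (u, v) = (a * \<sigma> u + b * \<sigma> v, c * \<sigma> u + d * \<sigma> v)"
proof -
  obtain \<sigma> where add: "\<And>u v. \<phi> (u + v) = \<phi> u + \<phi> v" and bij: "bij \<phi>"
    and \<sigma>: "field_automorphism \<sigma>" "\<And>c u. \<phi> (scale2 c u) = scale2 (\<sigma> c) (\<phi> u)"
    using assms by (auto simp: GammaL2_def)
  obtain a c where ac: "\<phi> (1, 0) = (a, c)" by fastforce
  obtain b d where bd: "\<phi> (0, 1) = (b, d)" by fastforce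
  have "\<phi> (u, v) = (a * \<sigma> u + b * \<sigma> v, c * \<sigma> u + d * \<sigma> v)" for u v
  proof -
    have "(u, v) = scale2 u (1, 0) + scale2 v (0, 1)" by (simp add: scale2_def)
    then show ?thesis by (simp only: add \<sigma>(2) ac bd) (simp add: scale2_def mult.commute)
  qed
  moreover have "b \<noteq> 0 \<or> d \<noteq> 0"
  proof (rule ccontr)
    assume "\<not> (b \<noteq> 0 \<or> d \<noteq> 0)"
    have "\<phi> 0 = 0" using add[of 0 0] by (metis add_cancel_right_right add.right_neutral)
    then have "\<phi> (0, 1) = \<phi> 0" using bd \<open>\<not> (b \<noteq> 0 \<or> d \<noteq> 0)\<close>
      by (simp add: zero_prod_def)
    then have "(0::'a, 1::'a) = 0" using bij by (metis bij_is_inj injD)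
    then show False by (simp add: zero_prod_def)
  qed
  ultimately show ?thesis using that \<sigma>(1) by blast
qed

lemma GammaL2_image_span:
  fixes \<phi> :: "'a::field \<times> 'a \<Rightarrow> 'a \<times> 'a"
  assumes "\<phi> \<in> GammaL2"
  shows "\<phi> ` plane.span {u} = plane.span {\<phi> u}"
proof -
  obtain \<sigma> where \<sigma>: "field_automorphism \<sigma>" "\<And>c u. \<phi> (scale2 c u) = scale2 (\<sigma> c) (\<phi> u)"
    using assms by (auto simp: GammaL2_def)
  have "surj \<sigma>" using \<sigma>(1) by (simp add: field_automorphism_def bij_is_surj)
  have "\<phi> ` plane.span {u} = (\<lambda>c. scale2 c (\<phi> u)) ` range \<sigma>"
    by (simp add: span_singleton_pair image_image \<sigma>(2))
  then show ?thesis using \<open>surj \<sigma>\<close> by (simp add: span_singleton_pair)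
qed

text \<open>
  The image of \<open>linear_set f\<close> consists of the points spanned by \<open>(A u, B u)\<close>, with \<open>A\<close> and \<open>B\<close> the
  two coordinates of the semilinear map. As \<open>linear_set g\<close> misses the point at infinity, \<open>A u\<close>
  does not vanish for nonzero \<open>u\<close>.
\<close>

lemma PGammaL_equivalent_slopes:
  fixes f g :: "'a::field \<Rightarrow> 'a"
  assumes "PGammaL_equivalent (linear_set f) (linear_set g)" "f 0 = 0" "g 0 = 0"
  obtains \<sigma> a b c d where "field_automorphism \<sigma>" "b \<noteq> 0 \<or> d \<noteq> 0"
    "\<forall>u. u \<noteq> 0 \<longrightarrow> a * \<sigma> u + b * \<sigma> (f u) \<noteq> 0"
    "slopes g = (\<lambda>u. (c * \<sigma> u + d * \<sigma> (f u)) / (a * \<sigma> u + b * \<sigma> (f u))) ` (- {0})"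
proof -
  obtain \<phi> where \<phi>: "\<phi> \<in> GammaL2" and eq: "(\<lambda>P\<in>PG1. \<phi> ` P) ` linear_set f = linear_set g"
    using assms(1) by (auto simp: PGammaL_equivalent_def PGammaL2_def)
  obtain \<sigma> a b c d where abcd: "field_automorphism \<sigma>" "b \<noteq> 0 \<or> d \<noteq> 0"
    and co: "\<forall>u v. \<phi> (u, v) = (a * \<sigma> u + b * \<sigma> v, c * \<sigma> u + d * \<sigma> v)"
    by (rule GammaL2_coordinates[OF \<phi>]) (rule that; assumption)
  define A where "A u = a * \<sigma> u + b * \<sigma> (f u)" for u
  define B where "B u = c * \<sigma> u + d * \<sigma> (f u)" for u
  have "linear_set f \<subseteq> PG1"
    by (auto simp: linear_set_def PG1_def)
  then have "(\<lambda>P\<in>PG1. \<phi> ` P) ` linear_set f = (\<lambda>P. \<phi> ` P) ` linear_set f"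
    by (intro image_cong) auto
  also have "\<dots> = (\<lambda>u. plane.span {(A u, B u)}) ` (- {0})"
    by (simp only: linear_set_eq assms(2) image_image GammaL2_image_span[OF \<phi>] co A_def B_def)
  finally have pts: "(\<lambda>u. plane.span {(A u, B u)}) ` (- {0}) = (\<lambda>u. plane.span {(u, g u)}) ` (- {0})"
    using eq by (simp add: linear_set_eq assms(3))
  have fwd: "A u \<noteq> 0 \<and> B u / A u \<in> slopes g" if "u \<noteq> 0" for u
  proof -
    have "plane.span {(A u, B u)} \<in> (\<lambda>u. plane.span {(A u, B u)}) ` (- {0})"
      using that by (intro imageI) simp
    then obtain v where v: "v \<noteq> 0" "plane.span {(A u, B u)} = plane.span {(v, g v)}"
      unfolding pts by (elim imageE) simp
    have "(v, g v) \<in> plane.span {(A u, B u)}" unfolding v(2) by (rule plane.span_base) simp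
    moreover have "(v, g v) \<noteq> 0" using v(1) by (simp add: zero_prod_def)
    ultimately obtain e where "e \<noteq> 0" "(v, g v) = scale2 e (A u, B u)"
      by (rule mem_span_singleton_nonzero)
    then have "A u \<noteq> 0" "B u / A u = g v / v" using v(1) by (auto simp: scale2_def)
    then show ?thesis using v(1) by (auto simp: slopes_def)
  qed
  have bwd: "g v / v \<in> (\<lambda>u. B u / A u) ` (- {0})" if "v \<noteq> 0" for v
  proof -
    have "plane.span {(v, g v)} \<in> (\<lambda>v. plane.span {(v, g v)}) ` (- {0})"
      using that by (intro imageI) simp
    then obtain u where u: "u \<noteq> 0" "plane.span {(A u, B u)} = plane.span {(v, g v)}"
      unfolding pts[symmetric] by (elim imageE) simp
    have "(A u, B u) \<in> plane.span {(v, g v)}" unfolding u(2)[symmetric] by (rule plane.span_base) simp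
    moreover have "(A u, B u) \<noteq> 0" using fwd[OF u(1)] by (simp add: zero_prod_def)
    ultimately obtain e where "e \<noteq> 0" "(A u, B u) = scale2 e (v, g v)"
      by (rule mem_span_singleton_nonzero)
    then have "B u / A u = g v / v" using that by (auto simp: scale2_def)
    then show ?thesis using u(1) by (intro image_eqI[of _ _ u]) simp_all
  qed
  show ?thesis
  proof (rule that[OF abcd])
    show "slopes g = (\<lambda>u. (c * \<sigma> u + d * \<sigma> (f u)) / (a * \<sigma> u + b * \<sigma> (f u))) ` (- {0})"
      using fwd bwd unfolding A_def B_def by (auto simp: slopes_def)
  qed (use fwd in \<open>auto simp: A_def\<close>)
qed

context sextic_field
begin

text \<open>
  Every fibre of \<open>u \<mapsto> qpoly a u / u\<close> is an additive group without its zero, so its size is \<open>- 1\<close> in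
  the field. Therefore a sum over vectors is minus a sum over points, whatever the weights of the
  points are.
\<close>

lemma power_sum_slopes:
  fixes G :: "'a \<Rightarrow> 'a"
  shows "(\<Sum>u\<in>- {0}. G (qpoly a u / u)) = - (\<Sum>s\<in>slopes (qpoly a). G s)"
proof -
  have "(\<Sum>u\<in>- {0}. G (qpoly a u / u))
      = (\<Sum>s\<in>slopes (qpoly a). \<Sum>u | u \<in> - {0} \<and> qpoly a u / u = s. G (qpoly a u / u))"
    unfolding slopes_def by (rule sum.group[symmetric]) auto
  also have "\<dots> = (\<Sum>s\<in>slopes (qpoly a). - G s)"
  proof (intro sum.cong refl)
    fix s assume "s \<in> slopes (qpoly a)"
    then obtain w where w: "w \<noteq> 0" "s = qpoly a w / w" by (auto simp: slopes_def)
    then have sw: "qpoly a w = s * w" by simp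
    \<comment> \<open>The fibre over \<open>s\<close> together with 0 is an additive group containing \<open>w\<close>.\<close>
    define K where "K = {u. qpoly a u = s * u}"
    have "of_nat (card K) = (0::'a)"
      by (rule of_nat_card_additive_subgroup[of _ w])
         (simp_all add: K_def w(1) sw qpoly_add algebra_simps)
    moreover have "{u \<in> - {0}. qpoly a u / u = s} = K - {0}" by (auto simp: K_def field_simps)
    moreover have "0 \<in> K" by (simp add: K_def)
    ultimately have "of_nat (card {u \<in> - {0}. qpoly a u / u = s}) = (- 1 :: 'a)"
      by (metis (no_types, lifting) card_Suc_Diff1 eq_neg_iff_add_eq_0 finite of_nat_Suc add.commute)
    then show "(\<Sum>u | u \<in> - {0} \<and> qpoly a u / u = s. G (qpoly a u / u)) = - G s"
      by simp
  qed
  finally show ?thesis by (simp add: sum_negf)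
qed

text \<open>
  Both permanents are, up to sign, the same power sum over the points.
\<close>

lemma frob_permanent_cong:
  assumes "slopes (qpoly a) = slopes (qpoly b)" "D \<subseteq> {..<6}" "D \<noteq> {}"
  shows "frob_permanent a D = frob_permanent b D"
  using power_sum_slopes[of "\<lambda>s. s ^ (\<Sum>i\<in>D. q ^ i)"] power_sum_qpoly[OF assms(2,3)] assms(1)
  by (metis neg_equal_iff_equal)

lemma field_automorphism_simps:
  assumes "field_automorphism (\<sigma> :: 'a \<Rightarrow> 'a)"
  shows "\<sigma> (u + v) = \<sigma> u + \<sigma> v" "\<sigma> (u * v) = \<sigma> u * \<sigma> v" "\<sigma> 0 = 0" "\<sigma> 1 = 1"
    "\<sigma> (- u) = - \<sigma> u" "\<sigma> (u - v) = \<sigma> u - \<sigma> v" "\<sigma> (u ^ n) = \<sigma> u ^ n" "\<sigma> u = \<sigma> v \<longleftrightarrow> u = v"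
proof -
  have *: "\<And>u v. \<sigma> (u + v) = \<sigma> u + \<sigma> v" "\<And>u v. \<sigma> (u * v) = \<sigma> u * \<sigma> v" "inj \<sigma>" "surj \<sigma>"
    using assms by (auto simp: field_automorphism_def bij_def)
  show zero: "\<sigma> 0 = 0" using *(1)[of 0 0] by (metis add.right_neutral add_left_cancel)
  have "\<sigma> 1 \<noteq> 0" using *(3) zero by (metis injD zero_neq_one)
  then show one: "\<sigma> 1 = 1" using *(2)[of 1 1] by simp
  show neg: "\<sigma> (- u) = - \<sigma> u" for u
    using *(1)[of "- u" u] zero by (simp add: eq_neg_iff_add_eq_0)
  show "\<sigma> (u - v) = \<sigma> u - \<sigma> v" using *(1)[of u "- v"] neg by simp
  show "\<sigma> (u ^ n) = \<sigma> u ^ n" by (induction n) (simp_all add: one *(2))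
  show "\<sigma> u = \<sigma> v \<longleftrightarrow> u = v" using *(3) by (auto dest: injD)
qed (use assms in \<open>auto simp: field_automorphism_def\<close>)

definition fh_coeffs :: "'a \<Rightarrow> nat \<Rightarrow> 'a" where
  "fh_coeffs h = (!) [0, h ^ q / h, - (h ^ (q ^ 2) / h), 0, 1, 1]"

lemma L_h_eq:
  assumes "h \<noteq> 0"
  shows "L_h q h = linear_set (qpoly (fh_coeffs h))"
proof -
  have "h ^ (q - 1) = h ^ q / h" "h ^ (q ^ 2 - 1) = h ^ (q ^ 2) / h"
    using assms q_ge_3 by (simp_all add: power_diff)
  then show ?thesis
    by (simp add: L_h_def qpoly_def[abs_def] fh_coeffs_def sum_upto_6)
qed

text \<open>
  If \<open>A u = t * u + e * f u\<close> is bijective and \<open>B u = c * u + d * f u\<close>, the quotients \<open>B u / A u\<close> are the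
  slopes of the \<open>q\<close>-polynomial \<open>B \<circ> A\<^sup>-\<^sup>1\<close>.
\<close>

lemma fractional_linear_image:
  assumes nz: "\<forall>u. u \<noteq> 0 \<longrightarrow> t * u + e * qpoly f u \<noteq> 0"
    and sl: "S = (\<lambda>u. (c * u + d * qpoly f u) / (t * u + e * qpoly f u)) ` (- {0})"
  obtains a where "slopes (qpoly a) = S"
    "\<forall>u. c * u + d * qpoly f u = qpoly a (t * u + e * qpoly f u)"
proof -
  have lin: "c * u + d * qpoly f u = qpoly (\<lambda>j. (if j = 0 then c else 0) + d * f j) u" for c d u
    by (simp add: qpoly_def sum_upto_6 algebra_simps)
  define A where "A j = (if j = 0 then t else 0) + e * f j" for j :: nat
  define B where "B j = (if j = 0 then c else 0) + d * f j" for j :: nat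
  have AB: "t * u + e * qpoly f u = qpoly A u" "c * u + d * qpoly f u = qpoly B u" for u
    unfolding A_def B_def by (rule lin)+
  obtain A' where A': "\<And>u. qpoly A' (qpoly A u) = u" "\<And>u. qpoly A (qpoly A' u) = u"
    using inv_qpoly[of A] nz unfolding AB by blast
  have bij: "bij_betw (qpoly A) (- {0}) (- {0})"
    by (rule bij_betw_byWitness[where f' = "qpoly A'"]) (use A' qpoly_0 in \<open>auto, metis+\<close>)
  show ?thesis
  proof
    have comp: "c * u + d * qpoly f u = qpoly (qcomp B A') (t * u + e * qpoly f u)" for u
      unfolding AB by (simp add: A' flip: qpoly_qcomp)
    then show "\<forall>u. c * u + d * qpoly f u = qpoly (qcomp B A') (t * u + e * qpoly f u)" ..
    have "slopes (qpoly (qcomp B A')) = (\<lambda>u. qpoly (qcomp B A') u / u) ` (qpoly A ` (- {0}))"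
      using bij by (simp add: slopes_def bij_betw_def)
    also have "\<dots> = S"
      unfolding sl image_image comp by (simp only: AB)
    finally show "slopes (qpoly (qcomp B A')) = S" .
  qed
qed

lemma field_automorphism_qpoly_fh:
  assumes "field_automorphism \<sigma>"
  shows "\<sigma> (qpoly (fh_coeffs h) u) = qpoly (fh_coeffs (\<sigma> h)) (\<sigma> u)"
proof -
  note [simp] = field_automorphism_simps[OF assms]
  have "\<sigma> (v / w) = \<sigma> v / \<sigma> w" for v w
  proof (cases "w = 0")
    case False
    then have "\<sigma> w \<noteq> 0" by (metis field_automorphism_simps(3,8)[OF assms])
    moreover have "\<sigma> (v / w) * \<sigma> w = \<sigma> v" using False by (simp flip: field_automorphism_simps(2)[OF assms])
    ultimately show ?thesis by (simp add: field_simps)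
  qed simp
  then show ?thesis by (simp add: qpoly_def fh_coeffs_def sum_upto_6)
qed

text \<open>
  A field automorphism turns \<open>f_h\<close> into \<open>f_h'\<close>, with \<open>h'\<close> the image of \<open>h\<close>, so a semilinear equivalence
  from \<open>h\<close> becomes a linear one from \<open>h'\<close>. Scaling the matrix normalizes \<open>e\<close> to 0 or 1.
\<close>

lemma equivalence_normal_form:
  assumes "h ^ (q ^ 3 + 1) = - 1"
    and "PGammaL_equivalent (L_h q h) (linear_set (qpoly b))"
  obtains h' a t c d e where "h' ^ (q ^ 3 + 1) = - 1" "h' ^ q = h' \<longrightarrow> h ^ q = h"
    "slopes (qpoly a) = slopes (qpoly b)"
    "\<forall>u. c * u + d * qpoly (fh_coeffs h') u = qpoly a (t * u + e * qpoly (fh_coeffs h') u)"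
    "e = 1 \<or> e = 0 \<and> d \<noteq> 0"
proof -
  have "h \<noteq> 0" using assms(1) by auto
  obtain \<sigma> t e c d where \<sigma>: "field_automorphism \<sigma>" and de: "e \<noteq> 0 \<or> d \<noteq> 0"
    and nz: "\<forall>u. u \<noteq> 0 \<longrightarrow> t * \<sigma> u + e * \<sigma> (qpoly (fh_coeffs h) u) \<noteq> 0"
    and sl: "slopes (qpoly b) = (\<lambda>u. (c * \<sigma> u + d * \<sigma> (qpoly (fh_coeffs h) u))
        / (t * \<sigma> u + e * \<sigma> (qpoly (fh_coeffs h) u))) ` (- {0})"
    by (rule PGammaL_equivalent_slopes[OF assms(2)[unfolded L_h_eq[OF \<open>h \<noteq> 0\<close>]] qpoly_0 qpoly_0])
      (rule that; assumption)
  note s = field_automorphism_simps[OF \<sigma>]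
  define h' where "h' = \<sigma> h"
  define f where "f = fh_coeffs h'"
  have bij: "\<sigma> ` (- {0}) = - {0}"
  proof -
    have "bij \<sigma>" using \<sigma> by (simp add: field_automorphism_def)
    then show ?thesis by (simp add: bij_image_Compl_eq s)
  qed
  \<comment> \<open>Dividing all four matrix entries by \<open>m\<close> leaves the fractional map unchanged.\<close>
  define m where "m = (if e = 0 then 1 else e)"
  have m: "m \<noteq> 0" by (simp add: m_def)
  have nz': "\<forall>v. v \<noteq> 0 \<longrightarrow> t / m * v + e / m * qpoly f v \<noteq> 0"
  proof (intro allI impI)
    fix v :: 'a assume "v \<noteq> 0"
    then have "v \<in> \<sigma> ` (- {0})" by (simp add: bij)
    then obtain u where u: "v = \<sigma> u" "u \<noteq> 0" by (elim imageE) simp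
    have "t / m * v + e / m * qpoly f v = (t * v + e * qpoly f v) / m"
      by (simp add: add_divide_distrib)
    then show "t / m * v + e / m * qpoly f v \<noteq> 0"
      using nz u(2) m by (simp add: field_automorphism_qpoly_fh[OF \<sigma>] u f_def h'_def)
  qed
  have "slopes (qpoly b) = (\<lambda>v. (c * v + d * qpoly f v) / (t * v + e * qpoly f v)) ` \<sigma> ` (- {0})"
    unfolding sl image_image field_automorphism_qpoly_fh[OF \<sigma>] f_def h'_def ..
  also have "\<dots> = (\<lambda>v. (c / m * v + d / m * qpoly f v) / (t / m * v + e / m * qpoly f v)) ` (- {0})"
    unfolding bij using m by (intro image_cong refl) (simp flip: add_divide_distrib)
  finally have sl': "slopes (qpoly b)
      = (\<lambda>v. (c / m * v + d / m * qpoly f v) / (t / m * v + e / m * qpoly f v)) ` (- {0})" .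
  obtain a where a: "slopes (qpoly a) = slopes (qpoly b)"
    "\<forall>u. c / m * u + d / m * qpoly f u = qpoly a (t / m * u + e / m * qpoly f u)"
    by (rule fractional_linear_image[OF nz' sl']) (rule that; assumption)
  show ?thesis
  proof (rule that)
    have "h' ^ (q ^ 3 + 1) = \<sigma> (h ^ (q ^ 3 + 1))" by (simp only: h'_def s)
    then show "h' ^ (q ^ 3 + 1) = - 1" by (simp only: assms(1) s)
    have "h' ^ q = \<sigma> (h ^ q)" by (simp only: h'_def s)
    then show "h' ^ q = h' \<longrightarrow> h ^ q = h" using s(8)[of "h ^ q" h] by (simp add: h'_def)
    show "slopes (qpoly a) = slopes (qpoly b)" by (rule a(1))
    show "\<forall>u. c / m * u + d / m * qpoly (fh_coeffs h') u
        = qpoly a (t / m * u + e / m * qpoly (fh_coeffs h') u)"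
      using a(2) by (simp add: f_def)
    show "e / m = 1 \<or> e / m = 0 \<and> d / m \<noteq> 0"
      using de by (auto simp: m_def)
  qed
qed

end

section \<open>The coefficient equations\<close>

text \<open>
  The element \<open>x\<close> plays the role of \<open>h\<close> (or of its image under a field automorphism). Because
  \<open>x ^ (q ^ 3) = - 1 / x\<close>, all its conjugates are rational in \<open>x\<close>, \<open>y\<close> and \<open>z\<close>.
\<close>

locale conjugates = sextic_field q F
  for q :: nat and F :: "'a::{field, finite} itself" +
  fixes x y z :: 'a
  assumes y_def: "y = x ^ q" and z_def: "z = x ^ (q ^ 2)"
    and norm_minus_1: "x ^ (q ^ 3 + 1) = - 1"
begin

lemma nonzero [simp]: "x \<noteq> 0" "y \<noteq> 0" "z \<noteq> 0"
  using norm_minus_1 by (auto simp: y_def z_def frob_zero frob_zero1)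

lemma one_neq_minus_one [simp]: "(1::'a) \<noteq> - 1" "(- 1::'a) \<noteq> 1"
proof -
  show "(1::'a) \<noteq> - 1"
  proof
    assume "(1::'a) = - 1"
    then have "(2::'a) = 0" by (metis one_add_one add.right_inverse)
    then show False using two_neq_0 by simp
  qed
  then show "(- 1::'a) \<noteq> 1" by (rule not_sym)
qed

lemma conj1: "x ^ q = y" "y ^ q = z" "z ^ q = - 1 / x"
proof -
  show "x ^ q = y" "y ^ q = z" by (simp_all add: y_def z_def power2_eq_square flip: power_mult)
  have "z ^ q = x ^ (q ^ 3)"
    by (simp add: z_def power2_eq_square power3_eq_cube flip: power_mult)
  moreover have "x * x ^ (q ^ 3) = - 1" using norm_minus_1 by (simp add: mult.commute)
  ultimately show "z ^ q = - 1 / x" by (simp add: field_simps)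
qed

lemma conj_Suc: "(u::'a) ^ (q ^ Suc i) = (u ^ (q ^ i)) ^ q"
  by (simp add: mult.commute flip: power_mult)

lemma minus_frob1: "(- (u::'a)) ^ q = - (u ^ q)"
  using q_odd by simp

lemma frob_iter: "(u::'a) ^ (q ^ 2) = (u ^ q) ^ q" "u ^ (q ^ 3) = (u ^ (q ^ 2)) ^ q"
  "u ^ (q ^ 4) = (u ^ (q ^ 3)) ^ q" "u ^ (q ^ 5) = (u ^ (q ^ 4)) ^ q"
  using conj_Suc[of u 1] conj_Suc[of u 2] conj_Suc[of u 3] conj_Suc[of u 4]
  by (simp_all only: Suc_1 Suc_numeral add_num_simps power_one_right)

lemma conj2: "x ^ (q ^ 2) = z" "y ^ (q ^ 2) = - 1 / x" "z ^ (q ^ 2) = - 1 / y"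
  by (simp_all add: frob_iter conj1 power_divide minus_frob1)
lemma conj3: "x ^ (q ^ 3) = - 1 / x" "y ^ (q ^ 3) = - 1 / y" "z ^ (q ^ 3) = - 1 / z"
  by (simp_all add: frob_iter conj1 power_divide minus_frob1)
lemma conj4: "x ^ (q ^ 4) = - 1 / y" "y ^ (q ^ 4) = - 1 / z" "z ^ (q ^ 4) = x"
  by (simp_all add: frob_iter conj1 power_divide minus_frob1)
lemma conj5: "x ^ (q ^ 5) = - 1 / z" "y ^ (q ^ 5) = x" "z ^ (q ^ 5) = y"
  by (simp_all add: frob_iter conj1 power_divide minus_frob1)

lemmas conj = conj1 conj2 conj3 conj4 conj5
lemmas frob_arith = power_divide power_mult_distrib frob_minus minus_frob1 frob_add frob_diff
  frob_add1 frob_diff1 frob_zero frob_zero1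

text \<open>
  Here the oddness of \<open>q\<close> enters: \<open>q ^ 3 + 1\<close> is even, so an element of order at most 2 has norm 1
  instead of \<open>- 1\<close>.
\<close>

lemma x_sq_neq_1: "x\<^sup>2 \<noteq> 1"
proof
  assume "x\<^sup>2 = 1"
  moreover have "even (q ^ 3 + 1)" using q_odd by simp
  then obtain k where "q ^ 3 + 1 = 2 * k" by blast
  ultimately have "x ^ (q ^ 3 + 1) = 1" by (simp only: power_mult power_one)
  then show False using norm_minus_1 by simp
qed

lemma conj_sq_neq_1: "y\<^sup>2 \<noteq> 1" "z\<^sup>2 \<noteq> 1"
proof -
  have "(u ^ q)\<^sup>2 = 1 \<Longrightarrow> u\<^sup>2 = 1" for u :: 'a
  proof -
    assume "(u ^ q)\<^sup>2 = 1"
    then have "(u\<^sup>2 - 1) ^ q = 0" by (simp add: frob_arith power_commutes flip: power_mult) (simp add: mult.commute)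
    then show "u\<^sup>2 = 1" by simp
  qed
  then show "y\<^sup>2 \<noteq> 1" "z\<^sup>2 \<noteq> 1" using x_sq_neq_1 conj1 by metis+
qed

text \<open>
  This is \<open>x ^ (q ^ 2 + 1) \<noteq> 1\<close>: otherwise the square of the \<open>q ^ 2\<close>-power map fixes \<open>x\<close>, and since its
  cube does so too, \<open>x\<close> would lie in the field of order \<open>q ^ 2\<close>, with \<open>x\<^sup>2 = 1\<close>.
\<close>

lemma xz_neq_1: "x * z \<noteq> 1"
proof
  assume "x * z = 1"
  then have z: "z = 1 / x" by (simp add: field_simps)
  have "z ^ (q ^ 2) = 1 / x ^ (q ^ 2)" by (simp add: z frob_arith)
  then have "- 1 / y = x" unfolding conj by (simp add: z)
  then have "y = - 1 / x" by (simp add: field_simps)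
  then have "y ^ q = - 1 / y" by (simp add: frob_arith conj)
  then have "z = x" using \<open>- 1 / y = x\<close> by (simp add: conj)
  then show False using \<open>x * z = 1\<close> x_sq_neq_1 by (simp add: power2_eq_square)
qed

lemma x_plus_y_neq_0: "x + y \<noteq> 0"
proof
  assume "x + y = 0"
  then have y: "y = - x" by (simp add: add_eq_0_iff)
  then have "z = x" using conj1(2) by (simp add: frob_arith conj)
  then have "- 1 / x = y" using conj1 by metis
  then have "x\<^sup>2 = 1" using y by (simp add: field_simps power2_eq_square)
  then show False using x_sq_neq_1 by simp
qed

text \<open>
  Comparison of the coefficients of \<open>c * u + d * f_h u = a (t * u + e * f_h u)\<close>, except for the one of
  \<open>u\<close> itself, which merely determines \<open>c\<close>.
\<close>

lemma coefficient_equations: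
  assumes "\<forall>u. c * u + d * qpoly (fh_coeffs x) u = qpoly a (t * u + e * qpoly (fh_coeffs x) u)"
    and "e = 0 \<or> e = 1" "a 0 = 0"
  shows "d * y / x = a 1 * t ^ q + e * (a 2 + a 3 + a 5 * y * z)"
    and "- d * z / x = a 2 * t ^ (q ^ 2) + e * (a 1 * z / y + a 3 + a 4)"
    and "0 = a 3 * t ^ (q ^ 3) + e * (a 1 / (x * y) - a 2 / (x * z) + a 4 + a 5)"
    and "d = a 4 * t ^ (q ^ 4) + e * (a 2 / (y * z) + a 3 * x / y + a 5)"
    and "d = a 5 * t ^ (q ^ 5) + e * (a 1 - a 3 * x / z + a 4 * y / z)"
proof -
  define A where "A j = (if j = 0 then t else 0) + e * fh_coeffs x j" for j :: nat
  define B where "B j = (if j = 0 then c else 0) + d * fh_coeffs x j" for j :: nat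
  have lin: "c * u + d * qpoly f u = qpoly (\<lambda>j. (if j = 0 then c else 0) + d * f j) u" for c d f u
    by (simp add: qpoly_def sum_upto_6 algebra_simps)
  have "qpoly B u = qpoly (qcomp a A) u" for u
    using assms(1) unfolding lin A_def B_def qpoly_qcomp by blast
  then have "\<forall>k<6. B k = qcomp a A k" using qpoly_unique by blast
  then have eqs: "B 1 = qcomp a A 1" "B 2 = qcomp a A 2" "B 3 = qcomp a A 3"
    "B 4 = qcomp a A 4" "B 5 = qcomp a A 5" by simp_all
  have f: "fh_coeffs x 0 = 0" "fh_coeffs x (Suc 0) = y / x" "fh_coeffs x 2 = - (z / x)"
    "fh_coeffs x 3 = 0" "fh_coeffs x 4 = 1" "fh_coeffs x 5 = 1"
    by (simp_all add: fh_coeffs_def y_def z_def)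
  have e: "e ^ (q ^ i) = e" "e ^ q = e" for i
    using assms(2) by (auto simp: frob_zero frob_zero1)
  note expand = A_def B_def qcomp_def sum_upto_6 f e frob_arith conj assms(3)
  show "d * y / x = a 1 * t ^ q + e * (a 2 + a 3 + a 5 * y * z)"
    using eqs(1) by (simp add: expand algebra_simps flip: numeral_2_eq_2)
  show "- d * z / x = a 2 * t ^ (q ^ 2) + e * (a 1 * z / y + a 3 + a 4)"
    using eqs(2) by (simp add: expand algebra_simps flip: numeral_2_eq_2)
  show "0 = a 3 * t ^ (q ^ 3) + e * (a 1 / (x * y) - a 2 / (x * z) + a 4 + a 5)"
    using eqs(3) by (simp add: expand algebra_simps flip: numeral_2_eq_2)
  show "d = a 4 * t ^ (q ^ 4) + e * (a 2 / (y * z) + a 3 * x / y + a 5)"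
    using eqs(4) by (simp add: expand algebra_simps flip: numeral_2_eq_2)
  show "d = a 5 * t ^ (q ^ 5) + e * (a 1 - a 3 * x / z + a 4 * y / z)"
    using eqs(5) by (simp add: expand algebra_simps flip: numeral_2_eq_2)
qed

section \<open>Targets with two terms\<close>

text \<open>
  In this lemma and the next four, the hypotheses are those coefficient equations (for \<open>e = 1\<close>) that
  do not involve \<open>t\<close> when \<open>a\<close> is supported on the two named indices. They force the coefficients to
  vanish, because \<open>x\<^sup>2\<close>, \<open>y\<^sup>2\<close>, \<open>z\<^sup>2\<close> and \<open>x * z\<close> differ from 1 and \<open>x + y\<close> from 0.
\<close>

lemma support_12_trivial:
  assumes "0 = a1 / (x * y) - a2 / (x * z)" "d = a2 / (y * z)" "d = a1"
  shows "a1 = 0 \<and> a2 = 0"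
proof -
  have "a1 * z = a2 * y" "a1 * (y * z) = a2" using assms by (simp_all add: field_simps)
  then have "a1 * z * (y\<^sup>2 - 1) = 0" by algebra
  then have "a1 = 0" using conj_sq_neq_1 by simp
  then show ?thesis using \<open>a1 * (y * z) = a2\<close> by simp
qed

lemma support_45_trivial:
  assumes "d * y / x = a5 * y * z" "- d * z / x = a4" "0 = a4 + a5"
  shows "a4 = 0 \<and> a5 = 0"
proof -
  have "d = a5 * x * z" using assms(1) by (simp add: field_simps)
  moreover have "- (d * z) = a4 * x" using assms(2) by (simp add: field_simps)
  moreover have "a4 = - a5" using assms(3) by (simp add: eq_neg_iff_add_eq_0)
  ultimately have "a5 * x * (z\<^sup>2 - 1) = 0" by algebra
  then show ?thesis using conj_sq_neq_1 \<open>a4 = - a5\<close> by simp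
qed

lemma support_15_trivial:
  assumes "- d * z / x = a1 * z / y" "0 = a1 / (x * y) + a5" "d = a5"
  shows "a1 = 0"
proof -
  have "- (d * y * z) = a1 * x * z" using assms(1) by (simp add: field_simps)
  then have "- (d * y) = a1 * x" by (metis minus_mult_left mult_right_cancel nonzero(3))
  moreover have "a1 + a5 * x * y = 0" using assms(2) by (simp add: field_simps)
  ultimately have "a1 * (x\<^sup>2 - 1) = 0" using assms(3) by algebra
  then show ?thesis using x_sq_neq_1 by simp
qed

lemma support_14_trivial:
  assumes "- d * z / x = a1 * z / y + a4" "0 = a1 / (x * y) + a4" "d = a1 + a4 * y / z"
  shows "a1 = 0"
proof -
  have "- (d * z * y) = x * (a1 * z + a4 * y)" using assms(1) by (simp add: field_simps)
  moreover have "a1 + a4 * x * y = 0" using assms(2) by (simp add: field_simps)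
  moreover have "d * z = a1 * z + a4 * y" using assms(3) by (simp add: field_simps)
  ultimately have "a1 * (x + y) * (x * z - 1) = 0" using nonzero by algebra
  then show ?thesis using x_plus_y_neq_0 xz_neq_1 by simp
qed

lemma support_25_trivial:
  assumes "d * y / x = a2 + a5 * y * z" "0 = - a2 / (x * z) + a5" "d = a2 / (y * z) + a5"
  shows "a2 = 0"
proof -
  have "d * y = x * (a2 + a5 * y * z)" using assms(1) by (simp add: field_simps)
  moreover have "a2 = a5 * x * z" using assms(2) by (simp add: field_simps)
  moreover have "d * y * z = a2 + a5 * y * z" using assms(3) by (simp add: field_simps)
  ultimately have "a2 * (x + y) * (x * z - 1) = 0" by algebra
  then show ?thesis using x_plus_y_neq_0 xz_neq_1 by simp
qed

section \<open>Targets with three terms\<close>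

text \<open>
  A root of a quadratic equation over the field of order \<open>q ^ 2\<close> lies in that field, as its degree
  over it divides 3. Concretely, \<open>x\<close> and its two conjugates are roots of a nonzero polynomial of
  degree at most 2, so two of them coincide, and then all three do.
\<close>

lemma fixed_of_quadratic:
  assumes root: "P * x\<^sup>2 + Q * x + R = 0" and "Q \<noteq> 0"
    and fixed: "P ^ (q ^ 2) = P" "Q ^ (q ^ 2) = Q" "R ^ (q ^ 2) = R"
  shows "z = x"
proof -
  have step: "P * (u ^ (q ^ 2))\<^sup>2 + Q * u ^ (q ^ 2) + R = 0" if "P * u\<^sup>2 + Q * u + R = 0" for u
  proof -
    have "(P * u\<^sup>2 + Q * u + R) ^ (q ^ 2) = 0" by (simp add: that frob_zero)
    then show ?thesis
      by (simp add: frob_arith fixed power2_eq_square[of u] power2_eq_square[of "u ^ (q ^ 2)"])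
  qed
  \<comment> \<open>The conjugate of \<open>x\<close> under the fourth power of the Frobenius map.\<close>
  define w where "w = - 1 / y"
  have rz: "P * z\<^sup>2 + Q * z + R = 0" using step[OF root] by (simp add: conj)
  have rw: "P * w\<^sup>2 + Q * w + R = 0" using step[OF rz] by (simp add: conj w_def)
  have "(x - z) * (z - w) * (x - w) * Q = 0" using root rz rw by algebra
  then consider "x = z" | "z = w" | "x = w" using \<open>Q \<noteq> 0\<close> by auto
  then show ?thesis
  proof cases
    case 2
    then have "z ^ (q ^ 4) = w ^ (q ^ 4)" by simp
    then have "x = z" by (simp add: w_def frob_arith conj)
    then show ?thesis by simp
  next
    case 3
    then have "x ^ (q ^ 2) = w ^ (q ^ 2)" by simp
    then show ?thesis by (simp add: w_def frob_arith conj)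
  qed simp
qed

lemma frob_frob: "((u::'a) ^ (q ^ i)) ^ (q ^ j) = u ^ (q ^ ((i + j) mod 6))"
  by (simp add: frob_mod_6 power_add flip: power_mult)

text \<open>
  The equations are those for \<open>a u = A u ^ q + B u ^ (q ^ 3) + C u ^ (q ^ 5)\<close>. They determine \<open>t\<close> up to
  sign, namely \<open>t = \<epsilon> * (y + z)\<close>, and with it the ratios between \<open>A\<close>, \<open>B\<close> and \<open>C\<close>.
\<close>

lemma coefficient_ratio_135:
  assumes eqs: "d * y / x = A * t ^ q + (B + C * y * z)"
      "- d * z / x = A * z / y + B"
      "d = B * x / y + C"
      "d = C * t ^ (q ^ 5) + (A - B * x / z)"
    and "A \<noteq> 0" "C \<noteq> 0"
  obtains \<epsilon> where "\<epsilon> = 1 \<or> \<epsilon> = - 1" "A = - \<epsilon> * y * C"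
    "C * y * z * (1 - \<epsilon> * x) = - B * x * (y + z)"
proof -
  define t1 t2 t4 t5 where "t1 = t ^ q" and "t2 = t ^ (q ^ 2)" and "t4 = t ^ (q ^ 4)"
    and "t5 = t ^ (q ^ 5)"
  have t: "t1 ^ q = t2" "t5 ^ q = t" "t1 ^ (q ^ 3) = t4" "t5 ^ (q ^ 3) = t2"
    "t1 ^ (q ^ 5) = t" "t5 ^ (q ^ 5) = t4"
    using frob_frob[of t 1 1] frob_frob[of t 5 1] frob_frob[of t 1 3] frob_frob[of t 5 3]
      frob_frob[of t 1 5] frob_frob[of t 5 5]
    by (simp_all add: t1_def t2_def t4_def t5_def power2_eq_square)
  have p1: "d * y = x * (A * t1 + B + C * y * z)"
    using eqs(1) by (simp add: t1_def field_simps)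
  have p2: "- (d * z * y) = x * (A * z + B * y)" using eqs(2) by (simp add: field_simps)
  have p4: "d * y = B * x + C * y" using eqs(3) by (simp add: field_simps)
  have p5: "d * z = z * C * t5 + A * z - B * x" using eqs(4) by (simp add: t5_def field_simps)
  \<comment> \<open>Eliminating \<open>d\<close> and \<open>B\<close> leaves two relations between \<open>A\<close>, \<open>C\<close> and conjugates of \<open>t\<close>.
    Their product does not involve \<open>A\<close> or \<open>C\<close>.\<close>
  have s1: "x * A * t1 = (1 - x * z) * y * C"
    using p1 p4 by algebra
  have "z * x * (y * C * t5 + (x + y) * A) = 0"
    using p2 p4 p5 by algebra
  then have "y * C * t5 + (x + y) * A = 0" by simp
  then have s2: "y * C * t5 = - (x + y) * A" by algebra
  have "A * C * y * (t1 * t5 * x + (1 - x * z) * (x + y)) = 0"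
    using s1 s2 by algebra
  then have P: "t1 * t5 * x = - ((1 - x * z) * (x + y))"
    using \<open>A \<noteq> 0\<close> \<open>C \<noteq> 0\<close> by (simp add: eq_neg_iff_add_eq_0)
  \<comment> \<open>Three conjugates of this relation give the pairwise products of \<open>t\<close>, \<open>t2\<close>, \<open>t4\<close>, and thus \<open>t\<^sup>2\<close>.\<close>
  have "t2 * t * y = - ((1 - y * (- 1 / x)) * (y + z))"
    using arg_cong[OF P, of "\<lambda>u. u ^ q"] by (simp add: frob_arith conj t)
  then have P1: "t2 * t * y * x = - ((x + y) * (y + z))" by (simp add: field_simps)
  have "t4 * t2 * (- 1 / x) = - ((1 - (- 1 / x) * (- 1 / z)) * (- 1 / x + - 1 / y))"
    using arg_cong[OF P, of "\<lambda>u. u ^ (q ^ 3)"] by (simp add: frob_arith conj t)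
  then have P3: "t4 * t2 * x * y * z = (1 - x * z) * (x + y)" by (simp add: field_simps)
  have "t * t4 * (- 1 / z) = - ((1 - (- 1 / z) * y) * (- 1 / z + x))"
    using arg_cong[OF P, of "\<lambda>u. u ^ (q ^ 5)"] by (simp add: frob_arith conj t)
  then have P5: "t * t4 * z = - ((y + z) * (1 - x * z))" by (simp add: field_simps)
  have "(1 - x * z) * (x + y) * (t\<^sup>2 - (y + z)\<^sup>2) = 0"
    using P1 P3 P5 by algebra
  then have "t\<^sup>2 - (y + z)\<^sup>2 = 0"
    using xz_neq_1 x_plus_y_neq_0 by simp
  then have "(t - (y + z)) * (t + (y + z)) = 0" by algebra
  then have "t = y + z \<or> t = - (y + z)"
    by (simp only: mult_eq_0_iff right_minus_eq eq_neg_iff_add_eq_0)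
  then obtain \<epsilon> where \<epsilon>: "\<epsilon> = 1 \<or> \<epsilon> = - 1" "t = \<epsilon> * (y + z)" by fastforce
  have \<epsilon>2: "\<epsilon> * \<epsilon> = 1" using \<epsilon>(1) by auto
  have "t5 = \<epsilon> * (x + y)"
    using \<epsilon>(1) unfolding t5_def \<epsilon>(2) by (auto simp: frob_arith conj)
  then have "(x + y) * (A + \<epsilon> * y * C) = 0" using s2 by algebra
  then have A: "A = - \<epsilon> * y * C" using x_plus_y_neq_0 by (simp add: eq_neg_iff_add_eq_0)
  moreover have "y * (C * y * z * (1 - \<epsilon> * x) + B * x * (y + z)) = 0"
    using p2 p4 A by algebra
  then have "C * y * z * (1 - \<epsilon> * x) = - B * x * (y + z)"
    by (simp add: eq_neg_iff_add_eq_0)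
  ultimately show ?thesis using that \<epsilon>(1) by blast
qed

text \<open>
  The known values of \<open>A * C ^ q\<close> and \<open>B * B ^ (q ^ 3)\<close>, combined with the ratios between the
  coefficients, eliminate the coefficients and leave a relation between \<open>x\<close> and \<open>\<delta>\<close>.
\<close>

lemma norm_equation_135:
  assumes \<epsilon>: "\<epsilon> = 1 \<or> \<epsilon> = - 1" and A: "A = - \<epsilon> * y * C"
    and C: "C * y * z * (1 - \<epsilon> * x) = - B * x * (y + z)"
    and AC: "A * C ^ q = \<delta> ^ q" and BB: "B * B ^ (q ^ 3) = 1" and delta: "\<delta> ^ (q ^ 2) = \<delta>"
  shows "(\<delta> ^ q)\<^sup>2 * z\<^sup>2 * (1 - x\<^sup>2) = \<delta> * (y + z)\<^sup>2"
proof -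
  define C1 C2 C3 B3 \<delta>' where defs: "C1 = C ^ q" "C2 = C ^ (q ^ 2)" "C3 = C ^ (q ^ 3)"
    "B3 = B ^ (q ^ 3)" "\<delta>' = \<delta> ^ q"
  have \<epsilon>2: "\<epsilon> * \<epsilon> = 1" and \<epsilon>q: "\<epsilon> ^ q = \<epsilon>" "\<epsilon> ^ (q ^ i) = \<epsilon>" for i
    using \<epsilon> by (auto simp: frob_arith)
  have c: "C1 ^ q = C2" "C2 ^ q = C3" "\<delta>' ^ q = \<delta>"
    using delta by (simp_all add: defs frob_iter)
  \<comment> \<open>Three successive conjugates of the norm condition on \<open>A * C ^ q\<close>: together they express
    \<open>\<delta>'\<^sup>2 / \<delta>\<close> through \<open>C * C3\<close>, which \<open>B * B3 = 1\<close> makes explicit.\<close>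
  have e0: "\<delta>' = - (\<epsilon> * y * C * C1)" using AC by (simp add: A defs)
  have e1: "\<delta> = - (\<epsilon> * z * C1 * C2)"
    using arg_cong[OF e0, of "\<lambda>u. u ^ q"] by (simp add: c frob_arith conj \<epsilon>q defs(1)[symmetric])
  have "\<delta>' = - (\<epsilon> * (- 1 / x) * C2 * C3)"
    using arg_cong[OF e1, of "\<lambda>u. u ^ q"]
    by (simp add: c frob_arith conj \<epsilon>q defs(5)[symmetric])
  then have e2: "\<delta>' * x = \<epsilon> * C2 * C3" by (simp add: field_simps)
  have "C3 * (- 1 / y) * (- 1 / z) * (1 - \<epsilon> * (- 1 / x)) = - B3 * (- 1 / x) * (- 1 / y + - 1 / z)"
    using arg_cong[OF C, of "\<lambda>u. u ^ (q ^ 3)"]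
    by (simp add: frob_arith conj \<epsilon>q defs(3,4)[symmetric])
  then have C3: "C3 * (x + \<epsilon>) = - B3 * (y + z)" by (simp add: field_simps) algebra
  have BB': "B * B3 = 1" using BB by (simp add: defs)
  have CC: "C * C3 * y * z * (1 - x\<^sup>2) = \<epsilon> * x * (y + z)\<^sup>2"
    using C C3 BB' \<epsilon>2 by algebra
  have "\<delta>'\<^sup>2 * x * z = \<delta> * \<epsilon> * y * (C * C3)"
    using e0 e1 e2 \<epsilon>2 by algebra
  then have "x * (\<delta>'\<^sup>2 * z\<^sup>2 * (1 - x\<^sup>2) - \<delta> * (y + z)\<^sup>2) = 0"
    using CC \<epsilon>2 by algebra
  then show ?thesis by (simp add: defs)
qed

text \<open>
  The two roots of \<open>X\<^sup>2 + X - 1\<close> have sum \<open>- 1\<close>, and the Frobenius map permutes them.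
\<close>

lemma golden_conjugate:
  assumes "\<delta>\<^sup>2 + \<delta> = (1::'a)"
  shows "\<delta> ^ q = \<delta> \<or> \<delta> ^ q = - 1 - \<delta>" "\<delta> ^ (q ^ 2) = \<delta>"
proof -
  define \<delta>' where "\<delta>' = \<delta> ^ q"
  have "\<delta>'\<^sup>2 + \<delta>' = 1"
    using arg_cong[OF assms, of "\<lambda>u. u ^ q"]
    by (simp add: \<delta>'_def frob_arith power2_eq_square)
  then have "(\<delta>' - \<delta>) * (\<delta>' + 1 + \<delta>) = 0" using assms by algebra
  then have "\<delta>' - \<delta> = 0 \<or> \<delta>' + 1 + \<delta> = 0" by simp
  moreover have "\<delta>' = - 1 - \<delta>" if "\<delta>' + 1 + \<delta> = 0" using that by algebra
  ultimately show *: "\<delta> ^ q = \<delta> \<or> \<delta> ^ q = - 1 - \<delta>" by (auto simp: \<delta>'_def)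
  show "\<delta> ^ (q ^ 2) = \<delta>"
    unfolding frob_iter(1) using *
  proof
    assume "\<delta> ^ q = - 1 - \<delta>"
    then have "(\<delta> ^ q) ^ q = - 1 - \<delta> ^ q" by (simp add: frob_arith)
    then show "(\<delta> ^ q) ^ q = \<delta>" using \<open>\<delta> ^ q = - 1 - \<delta>\<close> by simp
  qed simp
qed

text \<open>
  Comparing the relation with its conjugate under the \<open>q ^ 3\<close>-power map gives a formula for \<open>(y / (x * z))\<^sup>2\<close>.
  The quotient \<open>y / (x * z)\<close> is itself fixed by the \<open>q ^ 2\<close>-power map, so the relation becomes a quadratic
  equation for \<open>x\<close> with coefficients in the field of order \<open>q ^ 2\<close>, and \<open>x\<close> lies in that field.
\<close>

lemma conjugate_relations_135:
  assumes eq: "(\<delta> ^ q)\<^sup>2 * z\<^sup>2 * (1 - x\<^sup>2) = \<delta> * (y + z)\<^sup>2"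
    and delta: "\<delta> \<noteq> 0" "\<delta> ^ (q ^ 2) = \<delta>"
  shows "z = x" "y = - 1 / x" "(\<delta> ^ q)\<^sup>2 * (x\<^sup>2)\<^sup>2 + \<delta> * (x\<^sup>2 - 1) = 0"
    "\<delta> ^ 3 = - ((\<delta> ^ q) ^ 3 * (x\<^sup>2) ^ 3)"
proof -
  define \<delta>' where d': "\<delta>' = \<delta> ^ q"
  have nz: "\<delta>' \<noteq> 0" using delta(1) q_ge_3 by (simp add: d')
  have "\<delta>' ^ q = \<delta>" using delta(2) by (simp add: d' frob_iter)
  then have c: "\<delta>' ^ (q ^ 2) = \<delta>'" "\<delta> ^ (q ^ 3) = \<delta>'" "\<delta>' ^ (q ^ 3) = \<delta>"
    using delta(2) by (simp_all add: frob_iter) (simp_all add: d' frob_iter)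
  have "\<delta>\<^sup>2 * (- 1 / z)\<^sup>2 * (1 - (- 1 / x)\<^sup>2) = \<delta>' * (- 1 / y + - 1 / z)\<^sup>2"
    using arg_cong[OF eq[folded d'], of "\<lambda>u. u ^ (q ^ 3)"]
    by (simp add: power2_eq_square[of "_::'a"] frob_arith conj c)
  moreover define X Y Z where "X = 1 / x" and "Y = 1 / y" and "Z = 1 / z"
  ultimately have "\<delta>\<^sup>2 * (- Z)\<^sup>2 * (1 - (- X)\<^sup>2) = \<delta>' * (- Y + - Z)\<^sup>2" by simp
  moreover have "x * X = 1" "y * Y = 1" "z * Z = 1" by (simp_all add: X_def Y_def Z_def)
  ultimately have eq3: "\<delta>\<^sup>2 * y\<^sup>2 * (x\<^sup>2 - 1) = \<delta>' * x\<^sup>2 * (y + z)\<^sup>2" by algebra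
  have "(x\<^sup>2 - 1) * (\<delta> ^ 3 * y\<^sup>2 + \<delta>' ^ 3 * x\<^sup>2 * z\<^sup>2) = 0"
    using eq[folded d'] eq3 by algebra
  then have cube: "\<delta> ^ 3 * y\<^sup>2 + \<delta>' ^ 3 * x\<^sup>2 * z\<^sup>2 = 0" using x_sq_neq_1 by simp
  \<comment> \<open>Written with \<open>K\<close>, the hypothesis is a quadratic equation for \<open>x\<close> over the field of order \<open>q ^ 2\<close>.\<close>
  define K where "K = y / (x * z)"
  have K: "K ^ (q ^ 2) = K" "K \<noteq> 0" "y = K * x * z"
    by (simp_all add: K_def frob_arith conj field_simps)
  have "z\<^sup>2 * (\<delta> * (1 + K * x)\<^sup>2 - \<delta>'\<^sup>2 * (1 - x\<^sup>2)) = 0"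
    using eq[folded d'] K(3) by algebra
  then have "\<delta> * (1 + K * x)\<^sup>2 - \<delta>'\<^sup>2 * (1 - x\<^sup>2) = 0" by simp
  then have root: "(\<delta> * K\<^sup>2 + \<delta>'\<^sup>2) * x\<^sup>2 + 2 * \<delta> * K * x + (\<delta> - \<delta>'\<^sup>2) = 0" by algebra
  have two: "(2::'a) ^ (q ^ 2) = 2"
    unfolding one_add_one[symmetric] frob_add by simp
  show zx: "z = x"
    by (rule fixed_of_quadratic[OF root])
       (use two_neq_0 delta nz K in
         \<open>simp_all add: frob_arith delta c K two power2_eq_square[of \<delta>'] power2_eq_square[of K]\<close>)
  then show yx: "y = - 1 / x" using conj1(1,3) by simp
  then have xy: "x * y = - 1" by simp
  have "(x\<^sup>2 - 1) * (\<delta>'\<^sup>2 * (x\<^sup>2)\<^sup>2 + \<delta> * (x\<^sup>2 - 1)) = 0"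
    using eq[folded d'] xy zx by algebra
  then show "(\<delta> ^ q)\<^sup>2 * (x\<^sup>2)\<^sup>2 + \<delta> * (x\<^sup>2 - 1) = 0" using x_sq_neq_1 by (simp add: d')
  have "\<delta> ^ 3 = - (\<delta>' ^ 3 * (x\<^sup>2) ^ 3)" using cube xy zx by algebra
  then show "\<delta> ^ 3 = - ((\<delta> ^ q) ^ 3 * (x\<^sup>2) ^ 3)" by (simp add: d')
qed

text \<open>
  The two polynomial relations satisfied by \<open>v = x\<^sup>2\<close> have few common roots. If \<open>\<delta>\<close> is fixed by the
  Frobenius map, the only one is \<open>v = - 1\<close> with \<open>\<delta> = 2\<close>, which happens in characteristic 5 for \<open>x\<close>
  in the field of order \<open>q\<close>. Otherwise it is \<open>v = \<delta>\<^sup>2\<close>, and then the permanent identity of order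
  four fails.
\<close>

lemma support_135_forces_char_5:
  assumes eqs: "d * y / x = A * t ^ q + (B + C * y * z)"
      "- d * z / x = A * z / y + B"
      "d = B * x / y + C"
      "d = C * t ^ (q ^ 5) + (A - B * x / z)"
    and delta: "\<delta>\<^sup>2 + \<delta> = 1"
    and AC: "A * C ^ q = \<delta> ^ q"
    and BB: "B * B ^ (q ^ 3) = 1"
    and perm: "A * A ^ q * A ^ (q ^ 2) * B ^ (q ^ 3) + B * C ^ q * C ^ (q ^ 2) * C ^ (q ^ 3)
      = 1 + \<delta> ^ q * \<delta> ^ (q ^ 2) * \<delta> ^ (q ^ 3)"
  shows "y = x \<and> (5::'a) = 0"
proof -
  have nz: "\<delta> \<noteq> 0" using delta by auto
  then have AC0: "A \<noteq> 0" "C \<noteq> 0" using AC q_ge_3 by (auto simp: frob_zero1)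
  note \<delta>q = golden_conjugate[OF delta]
  obtain \<epsilon> where \<epsilon>: "\<epsilon> = 1 \<or> \<epsilon> = - 1" and A: "A = - \<epsilon> * y * C"
    and C: "C * y * z * (1 - \<epsilon> * x) = - B * x * (y + z)"
    using coefficient_ratio_135[OF eqs AC0] by blast
  note ne = norm_equation_135[OF \<epsilon> A C AC BB \<delta>q(2)]
  note zy = conjugate_relations_135(1,2)[OF ne nz \<delta>q(2)]
  have xy: "x * y = - 1" using zy by simp
  define \<delta>' where d': "\<delta>' = \<delta> ^ q"
  note v = conjugate_relations_135(3,4)[OF ne nz \<delta>q(2), folded d']
  have nz': "\<delta>' \<noteq> 0" using nz q_ge_3 by (simp add: d')
  have d'q: "\<delta>' ^ q = \<delta>" using \<delta>q(2) by (simp add: d' frob_iter)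
  show ?thesis
  proof (cases "\<delta>' = \<delta>")
    case True
    have "\<delta> * (\<delta> * (x\<^sup>2)\<^sup>2 + x\<^sup>2 - 1) = 0" using v(1) True by algebra
    then have v1: "\<delta> * (x\<^sup>2)\<^sup>2 + x\<^sup>2 - 1 = 0" using nz by simp
    have "\<delta> ^ 3 * ((x\<^sup>2 + 1) * ((x\<^sup>2)\<^sup>2 - x\<^sup>2 + 1)) = 0" using v(2) True by algebra
    then consider "x\<^sup>2 + 1 = 0" | "(x\<^sup>2)\<^sup>2 - x\<^sup>2 + 1 = 0" using nz by auto
    then show ?thesis
    proof cases
      case 1
      \<comment> \<open>Here \<open>x\<^sup>2 = - 1\<close>, so \<open>x\<close> equals its conjugate \<open>- 1 / x\<close>.\<close>
      then have "\<delta> = 2" using v1 by algebra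
      then have "\<delta>\<^sup>2 + \<delta> - 1 = 5" by simp
      then have "(5::'a) = 0" using delta by simp
      moreover have "x * (y - x) = 0" using 1 xy by algebra
      ultimately show ?thesis by simp
    next
      case 2
      then have "(\<delta> + 1) * (x\<^sup>2 - 1) = 0" using v1 by algebra
      then have "\<delta> + 1 = 0" using x_sq_neq_1 by simp
      then have "\<delta> = - 1" by (simp add: eq_neg_iff_add_eq_0)
      then show ?thesis using delta by simp
    qed
  next
    case False
    then have d1: "\<delta>' = - 1 - \<delta>" using \<delta>q(1) by (simp add: d')
    have dd: "\<delta> * \<delta>' = - 1" using d1 delta by algebra
    have v1: "(x\<^sup>2)\<^sup>2 + \<delta> ^ 3 * (x\<^sup>2 - 1) = 0" using v(1) dd by algebra
    have v2: "(x\<^sup>2) ^ 3 = \<delta> ^ 6" using v(2) dd by algebra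
    have "2 * \<delta> ^ 4 * (x\<^sup>2 - \<delta>\<^sup>2) = 0" using v1 v2 delta by algebra
    \<comment> \<open>For \<open>x = \<delta>\<close> and \<open>x = - \<delta>\<close> the contradiction comes from the permanent of the exponents
      \<open>{0, 1, 2, 3}\<close>.\<close>
    then have vd: "x\<^sup>2 = \<delta>\<^sup>2" using two_neq_0 nz by simp
    define B1 C1 where "B1 = B ^ q" and "C1 = C ^ q"
    have \<epsilon>2: "\<epsilon> * \<epsilon> = 1" and \<epsilon>q: "\<epsilon> ^ q = \<epsilon>" using \<epsilon> by (auto simp: frob_arith)
    have "x * (1 - \<epsilon> * x) * (C + (1 + \<epsilon> * x) * B) = 0" using C xy zy(1) \<epsilon>2 by algebra
    moreover have "1 - \<epsilon> * x \<noteq> 0"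
    proof
      assume "1 - \<epsilon> * x = 0"
      then have "x\<^sup>2 = 1" using \<epsilon>2 by algebra
      then show False using x_sq_neq_1 by simp
    qed
    ultimately have C0: "C = - ((1 + \<epsilon> * x) * B)" by (simp add: eq_neg_iff_add_eq_0)
    have C1: "C1 = - ((1 + \<epsilon> * y) * B1)"
      unfolding C1_def C0 by (simp add: frob_arith conj \<epsilon>q B1_def)
    have AC': "- \<epsilon> * y * C * C1 = \<delta>'" using AC by (simp add: A C1_def d')
    have "\<delta>' * (B * B1 - 1) = 0"
      using AC' C0 C1 xy vd \<epsilon>2 dd delta d1 by algebra
    then have BB1: "B * B1 = 1" using nz' by simp
    have "B1 * B1 ^ q = 1" using arg_cong[OF BB1, of "\<lambda>u. u ^ q"] by (simp add: frob_arith B1_def)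
    then have B1q: "B1 ^ q = B"
      using BB1 by (metis mult.commute mult_cancel_left zero_neq_one mult_zero_left)
    have C1q: "C1 ^ q = C"
      using \<epsilon>q B1q zy(1) by (simp add: C1 C0 frob_arith conj)
    have pw: "B ^ (q ^ 3) = B1" "C ^ (q ^ 2) = C" "C ^ (q ^ 3) = C1" "\<delta> ^ (q ^ 2) = \<delta>"
      "\<delta> ^ (q ^ 3) = \<delta>'" "C ^ q = C1" "\<delta> ^ q = \<delta>'"
      using B1q C1q d'q by (simp_all add: frob_iter B1_def C1_def d')
    have A1: "A ^ q = - \<epsilon> * x * C1" "A ^ (q ^ 2) = A"
      using C1q \<epsilon>q zy by (simp_all add: A frob_iter frob_arith conj C1_def)
    \<comment> \<open>The left-hand side evaluates to \<open>2 * \<delta>'\<close> and the right-hand side to \<open>1 - \<delta>'\<close>.\<close>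
    have "A * (- \<epsilon> * x * C1) * A * B1 + B * C1 * C * C1 = 1 + \<delta>' * \<delta> * \<delta>'"
      using perm by (simp add: A1 pw)
    moreover have "A * (- \<epsilon> * x * C1) * A * B1 = \<epsilon> * y * (C * C1) * (C * B1)"
      using A xy \<epsilon>2 by algebra
    moreover have CB: "C * B1 = - (1 + \<epsilon> * x)" "B * C1 = - (1 + \<epsilon> * y)"
      using C0 C1 BB1 by algebra+
    moreover have "C * C1 = (1 + \<epsilon> * x) * (1 + \<epsilon> * y)"
      using C0 C1 BB1 by algebra
    moreover have "y\<^sup>2 = \<delta>'\<^sup>2" using vd xy dd by algebra
    ultimately have "2 - 2 * \<delta>'\<^sup>2 = 1 + \<delta>' * \<delta> * \<delta>'"
      using xy \<epsilon>2 by algebra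
    moreover have "\<delta>'\<^sup>2 = 1 - \<delta>'" using d1 delta by algebra
    moreover have "\<delta>' * \<delta> * \<delta>' = - \<delta>'" using dd by algebra
    ultimately have "2 * \<delta>' = 1 - \<delta>'" by (simp add: right_diff_distrib)
    moreover have "(3::'a) * \<delta>' = (2 + 1) * \<delta>'" by simp
    ultimately have 3: "3 * \<delta>' = 1" by (simp only: distrib_right mult_1 diff_add_cancel)
    have "(3::'a) ^ q = 3"
    proof -
      have "(3::'a) = 1 + 1 + 1" by simp
      then show ?thesis by (metis frob_add1 power_one)
    qed
    \<comment> \<open>Conjugating \<open>3 * \<delta>' = 1\<close> shows that \<open>\<delta>\<close> and \<open>\<delta>'\<close> agree unless 3 vanishes.\<close>
    then have "3 * \<delta> = 1"
      using arg_cong[OF 3, of "\<lambda>u. u ^ q"] by (simp add: frob_arith d'q)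
    then have "3 * (\<delta> - \<delta>') = 0" using 3 by algebra
    then have "(3::'a) = 0" using False by simp
    then show ?thesis using 3 by simp
  qed
qed

end

section \<open>The four known families\<close>

context sextic_field
begin

lemma permanent_identities:
  assumes "slopes (qpoly a) = slopes (qpoly b)" "b 0 = 0"
  shows "a 0 = 0"
    and "a 1 * a 5 ^ q = b 1 * b 5 ^ q"
    and "a 2 * a 4 ^ (q ^ 2) = b 2 * b 4 ^ (q ^ 2)"
    and "a 3 * a 3 ^ (q ^ 3) = b 3 * b 3 ^ (q ^ 3)"
    and "a 1 ^ (1 + q) * a 4 ^ (q ^ 2) + a 2 * a 5 ^ (q + q ^ 2)
      = b 1 ^ (1 + q) * b 4 ^ (q ^ 2) + b 2 * b 5 ^ (q + q ^ 2)"
proof -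
  note eq = frob_permanent_cong[OF assms(1)]
  show a0: "a 0 = 0" using eq[of "{0}"] by (simp add: frob_permanent_1 assms(2))
  have p2: "frob_permanent a {0, i} = a i * a (6 - i) ^ (q ^ i)"
    "frob_permanent b {0, i} = b i * b (6 - i) ^ (q ^ i)" if "0 < i" "i < 6" for i
    using frob_permanent_2 that a0 assms(2) by blast+
  show "a 1 * a 5 ^ q = b 1 * b 5 ^ q"
    using eq[of "{0, 1}"] p2[of 1] by simp
  show "a 2 * a 4 ^ (q ^ 2) = b 2 * b 4 ^ (q ^ 2)"
    using eq[of "{0, 2}"] p2[of 2] by simp
  show "a 3 * a 3 ^ (q ^ 3) = b 3 * b 3 ^ (q ^ 3)"
    using eq[of "{0, 3}"] p2[of 3] by simp
  show "a 1 ^ (1 + q) * a 4 ^ (q ^ 2) + a 2 * a 5 ^ (q + q ^ 2)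
      = b 1 ^ (1 + q) * b 4 ^ (q ^ 2) + b 2 * b 5 ^ (q + q ^ 2)"
    using eq[of "{0, 1, 2}"] frob_permanent_012[of a] frob_permanent_012[of b] a0 assms(2)
    by simp
qed

text \<open>
  The normal form with \<open>e = 1\<close>. The case \<open>e = 0\<close> contradicts the permanent identity for
  \<open>{0, 2}\<close>, whose value for \<open>b\<close> is zero.
\<close>

lemma equivalence_equations:
  assumes "h ^ (q ^ 3 + 1) = - 1"
    and "PGammaL_equivalent (L_h q h) (linear_set (qpoly b))"
    and "b 0 = 0" "b 2 = 0 \<or> b 4 = 0"
  obtains x a t c d where "x ^ (q ^ 3 + 1) = - 1" "x ^ q = x \<longrightarrow> h ^ q = h"
    "slopes (qpoly a) = slopes (qpoly b)"
    "\<forall>u. c * u + d * qpoly (fh_coeffs x) u = qpoly a (t * u + 1 * qpoly (fh_coeffs x) u)"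
proof -
  obtain x a t c d e where norm: "x ^ (q ^ 3 + 1) = - 1" and fixed: "x ^ q = x \<longrightarrow> h ^ q = h"
    and sl: "slopes (qpoly a) = slopes (qpoly b)"
    and comp: "\<forall>u. c * u + d * qpoly (fh_coeffs x) u = qpoly a (t * u + e * qpoly (fh_coeffs x) u)"
    and e: "e = 1 \<or> e = 0 \<and> d \<noteq> 0"
    by (rule equivalence_normal_form[OF assms(1,2)]) (rule that; assumption)
  interpret c: conjugates q F x "x ^ q" "x ^ (q ^ 2)"
    by unfold_locales (simp_all only: norm)
  note perm = permanent_identities[OF sl assms(3)]
  have "e = 0 \<or> e = 1" using e by blast
  note eqs = c.coefficient_equations[OF comp this perm(1)]
  have "e = 1"
  proof (rule ccontr)
    assume "e \<noteq> 1"
    then have "e = 0" "d \<noteq> 0" using e by auto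
    \<comment> \<open>For \<open>e = 0\<close> the left-hand side has nonzero coefficients at the indices 2 and 4, and each is
      a multiple of the coefficient of \<open>a\<close> with the same index.\<close>
    then have "a 2 \<noteq> 0" "a 4 \<noteq> 0" using eqs(2,4) c.nonzero by auto
    then have "a 2 * a 4 ^ (q ^ 2) \<noteq> 0" by simp
    then show False using perm(3) assms(4) q_ge_3 by (auto simp: frob_zero)
  qed
  show ?thesis
    by (rule that[OF norm fixed sl comp[unfolded \<open>e = 1\<close>]])
qed

text \<open>
  The permanents of order at most three leave the supports \<open>{1, 2}\<close> and \<open>{4, 5}\<close> for the transformed
  polynomial; both make it zero, although \<open>x ^ q\<close> has the slope 1.
\<close>

lemma not_equivalent_L1:
  fixes h :: 'a
  assumes "h ^ (q ^ 3 + 1) = - 1"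
  shows "\<not> PGammaL_equivalent (L_h q h) (L1 q)"
proof
  define b :: "nat \<Rightarrow> 'a" where "b = (!) [0, 1, 0, 0, 0, 0]"
  have b: "b 0 = 0" "b (Suc 0) = 1" "b 2 = 0" "b 3 = 0" "b 4 = 0" "b 5 = 0" by (simp_all add: b_def)
  have L1: "L1 q = linear_set (qpoly b)"
    by (simp add: L1_def qpoly_def[abs_def] sum_upto_6 b)
  assume "PGammaL_equivalent (L_h q h) (L1 q)"
  then obtain x a t c d where norm: "x ^ (q ^ 3 + 1) = - 1"
    and sl: "slopes (qpoly a) = slopes (qpoly b)"
    and comp: "\<forall>u. c * u + d * qpoly (fh_coeffs x) u = qpoly a (t * u + 1 * qpoly (fh_coeffs x) u)"
    unfolding L1 by (rule equivalence_equations[OF assms _ b(1) disjI1[OF b(3)]]) (rule that; assumption)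
  interpret c: conjugates q F x "x ^ q" "x ^ (q ^ 2)"
    by unfold_locales (simp_all only: norm)
  note perm = permanent_identities[OF sl b(1)]
  note eqs = c.coefficient_equations[OF comp disjI2[OF refl] perm(1)]
  have a3: "a 3 = 0" using perm(4) by (simp add: b frob_zero)
  have "a 1 = 0 \<or> a 5 = 0" "a 2 = 0 \<or> a 4 = 0"
    "a 1 ^ (1 + q) * a 4 ^ (q ^ 2) + a 2 * a 5 ^ (q + q ^ 2) = 0"
    using perm(2,3,5) by (simp_all add: b frob_zero frob_zero1)
  then have "a 4 = 0 \<and> a 5 = 0 \<or> a 1 = 0 \<and> a 2 = 0"
    by (auto simp: frob_zero frob_zero1)
  then have "a 1 = 0 \<and> a 2 = 0 \<and> a 4 = 0 \<and> a 5 = 0"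
  proof
    assume z: "a 4 = 0 \<and> a 5 = 0"
    have "a 1 = 0 \<and> a 2 = 0"
      by (rule c.support_12_trivial[of _ _ d])
         (use eqs(3) z a3 in simp, use eqs(4) z a3 in simp, use eqs(5) z a3 in simp)
    with z show ?thesis by blast
  next
    assume z: "a 1 = 0 \<and> a 2 = 0"
    have "a 4 = 0 \<and> a 5 = 0"
      by (rule c.support_45_trivial[of d])
         (use eqs(1) z a3 in simp, use eqs(2) z a3 in simp, use eqs(3) z a3 in simp)
    with z show ?thesis by blast
  qed
  then have "qpoly a u = 0" for u using perm(1) a3 by (simp add: qpoly_def sum_upto_6)
  then have sub: "slopes (qpoly a) \<subseteq> {0}" by (auto simp: slopes_def)
  have "qpoly b 1 / 1 \<in> slopes (qpoly b)" unfolding slopes_def by (intro imageI) simp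
  then have one: "1 \<in> slopes (qpoly a)" by (simp add: qpoly_def sum_upto_6 b sl)
  show False using subsetD[OF sub one] by simp
qed

text \<open>
  The permanents confine the transformed polynomial to the support \<open>{1, 5}\<close>, with both coefficients
  nonzero.
\<close>

lemma not_equivalent_L2:
  fixes h \<delta> :: 'a
  assumes "h ^ (q ^ 3 + 1) = - 1" "\<delta> \<noteq> 0"
  shows "\<not> PGammaL_equivalent (L_h q h) (L2 q \<delta>)"
proof
  define b :: "nat \<Rightarrow> 'a" where "b = (!) [0, \<delta>, 0, 0, 0, 1]"
  have b: "b 0 = 0" "b (Suc 0) = \<delta>" "b 2 = 0" "b 3 = 0" "b 4 = 0" "b 5 = 1" by (simp_all add: b_def)
  have L2: "L2 q \<delta> = linear_set (qpoly b)"
    by (simp add: L2_def qpoly_def[abs_def] sum_upto_6 b)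
  assume "PGammaL_equivalent (L_h q h) (L2 q \<delta>)"
  then obtain x a t c d where norm: "x ^ (q ^ 3 + 1) = - 1"
    and sl: "slopes (qpoly a) = slopes (qpoly b)"
    and comp: "\<forall>u. c * u + d * qpoly (fh_coeffs x) u = qpoly a (t * u + 1 * qpoly (fh_coeffs x) u)"
    unfolding L2 by (rule equivalence_equations[OF assms(1) _ b(1) disjI1[OF b(3)]]) (rule that; assumption)
  interpret c: conjugates q F x "x ^ q" "x ^ (q ^ 2)"
    by unfold_locales (simp_all only: norm)
  note perm = permanent_identities[OF sl b(1)]
  note eqs = c.coefficient_equations[OF comp disjI2[OF refl] perm(1)]
  have a3: "a 3 = 0" using perm(4) by (simp add: b frob_zero)
  have "a 1 * a 5 ^ q = \<delta>" "a 2 = 0 \<or> a 4 = 0"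
    "a 1 ^ (1 + q) * a 4 ^ (q ^ 2) + a 2 * a 5 ^ (q + q ^ 2) = 0"
    using perm(2,3,5) by (simp_all add: b frob_zero frob_zero1)
  then have "a 1 \<noteq> 0" "a 2 = 0" "a 4 = 0"
    using assms(2) by (auto simp: frob_zero frob_zero1)
  note z = this a3
  have "a 1 = 0"
    by (rule c.support_15_trivial[of d _ "a 5"])
       (use eqs(2) z in simp, use eqs(3) z in simp, use eqs(4) z in simp)
  then show False using z by blast
qed

text \<open>
  The permanents allow the support \<open>{1, 4}\<close> of the target and the support \<open>{2, 5}\<close> of its adjoint,
  which defines the same linear set.
\<close>

lemma not_equivalent_L3:
  fixes h \<delta> :: 'a
  assumes "h ^ (q ^ 3 + 1) = - 1" "\<delta> \<noteq> 0"
  shows "\<not> PGammaL_equivalent (L_h q h) (L3 q \<delta>)"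
proof
  define b :: "nat \<Rightarrow> 'a" where "b = (!) [0, 1, 0, 0, \<delta>, 0]"
  have b: "b 0 = 0" "b (Suc 0) = 1" "b 2 = 0" "b 3 = 0" "b 4 = \<delta>" "b 5 = 0" by (simp_all add: b_def)
  have L3: "L3 q \<delta> = linear_set (qpoly b)"
    by (simp add: L3_def qpoly_def[abs_def] sum_upto_6 b)
  assume "PGammaL_equivalent (L_h q h) (L3 q \<delta>)"
  then obtain x a t c d where norm: "x ^ (q ^ 3 + 1) = - 1"
    and sl: "slopes (qpoly a) = slopes (qpoly b)"
    and comp: "\<forall>u. c * u + d * qpoly (fh_coeffs x) u = qpoly a (t * u + 1 * qpoly (fh_coeffs x) u)"
    unfolding L3 by (rule equivalence_equations[OF assms(1) _ b(1) disjI1[OF b(3)]]) (rule that; assumption)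
  interpret c: conjugates q F x "x ^ q" "x ^ (q ^ 2)"
    by unfold_locales (simp_all only: norm)
  note perm = permanent_identities[OF sl b(1)]
  note eqs = c.coefficient_equations[OF comp disjI2[OF refl] perm(1)]
  have a3: "a 3 = 0" using perm(4) by (simp add: b frob_zero)
  have "a 1 = 0 \<or> a 5 = 0" "a 2 = 0 \<or> a 4 = 0"
    "a 1 ^ (1 + q) * a 4 ^ (q ^ 2) + a 2 * a 5 ^ (q + q ^ 2) \<noteq> 0"
    using perm(2,3,5) q_ge_3 assms(2) by (simp_all add: b frob_zero frob_zero1)
  then have "a 1 \<noteq> 0 \<and> a 2 = 0 \<and> a 5 = 0 \<or> a 2 \<noteq> 0 \<and> a 1 = 0 \<and> a 4 = 0"
    using q_ge_3 by (auto simp: frob_zero frob_zero1)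
  then show False
  proof
    assume z: "a 1 \<noteq> 0 \<and> a 2 = 0 \<and> a 5 = 0"
    have "a 1 = 0"
      by (rule c.support_14_trivial[of d _ "a 4"])
         (use eqs(2) z a3 in simp, use eqs(3) z a3 in simp, use eqs(5) z a3 in simp)
    then show False using z by blast
  next
    assume z: "a 2 \<noteq> 0 \<and> a 1 = 0 \<and> a 4 = 0"
    have "a 2 = 0"
      by (rule c.support_25_trivial[of d _ "a 5"])
         (use eqs(1) z a3 in simp, use eqs(3) z a3 in simp, use eqs(4) z a3 in simp)
    then show False using z by blast
  qed
qed

text \<open>
  The permanents confine the transformed polynomial to the support \<open>{1, 3, 5}\<close>. The permanent of order
  four contains products of smaller ones, which cancel on both sides.
\<close>

lemma not_equivalent_L4:
  fixes h \<delta> :: 'a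
  assumes "h ^ (q ^ 3 + 1) = - 1" "\<delta>\<^sup>2 + \<delta> = 1"
    and "\<not> (h ^ q = h \<and> (5::'a) = 0)"
  shows "\<not> PGammaL_equivalent (L_h q h) (L4 q \<delta>)"
proof
  define b :: "nat \<Rightarrow> 'a" where "b = (!) [0, 1, 0, 1, 0, \<delta>]"
  have b: "b 0 = 0" "b (Suc 0) = 1" "b 2 = 0" "b 3 = 1" "b 4 = 0" "b 5 = \<delta>" by (simp_all add: b_def)
  have L4: "L4 q \<delta> = linear_set (qpoly b)"
    by (simp add: L4_def qpoly_def[abs_def] sum_upto_6 b)
  assume "PGammaL_equivalent (L_h q h) (L4 q \<delta>)"
  then obtain x a t c d where norm: "x ^ (q ^ 3 + 1) = - 1" and fixed: "x ^ q = x \<longrightarrow> h ^ q = h"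
    and sl: "slopes (qpoly a) = slopes (qpoly b)"
    and comp: "\<forall>u. c * u + d * qpoly (fh_coeffs x) u = qpoly a (t * u + 1 * qpoly (fh_coeffs x) u)"
    unfolding L4 by (rule equivalence_equations[OF assms(1) _ b(1) disjI1[OF b(3)]]) (rule that; assumption)
  interpret c: conjugates q F x "x ^ q" "x ^ (q ^ 2)"
    by unfold_locales (simp_all only: norm)
  note perm = permanent_identities[OF sl b(1)]
  note eqs = c.coefficient_equations[OF comp disjI2[OF refl] perm(1)]
  have "\<delta> \<noteq> 0" using assms(2) by auto
  have a15: "a 1 * a 5 ^ q = \<delta> ^ q" and "a 2 = 0 \<or> a 4 = 0"
    "a 1 ^ (1 + q) * a 4 ^ (q ^ 2) + a 2 * a 5 ^ (q + q ^ 2) = 0"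
    and a33: "a 3 * a 3 ^ (q ^ 3) = 1"
    using perm(2,3,4,5) by (simp_all add: b frob_zero frob_zero1)
  then have a24: "a 2 = 0" "a 4 = 0"
    using \<open>\<delta> \<noteq> 0\<close> q_ge_3 by (auto simp: frob_zero frob_zero1)
  have "a 1 * a 5 ^ q * (a 1 * a 5 ^ q) ^ (q ^ 2) + a 3 ^ (1 + q ^ 3) * (a 1 * a 5 ^ q) ^ q
      + a 1 ^ (1 + q + q ^ 2) * a 3 ^ (q ^ 3) + a 3 * a 5 ^ (q + q ^ 2 + q ^ 3)
    = \<delta> ^ q * (\<delta> ^ q) ^ (q ^ 2) + (\<delta> ^ q) ^ q + 1 + \<delta> ^ (q + q ^ 2 + q ^ 3)"
    using frob_permanent_cong[OF sl, of "{0, 1, 2, 3}"]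
      frob_permanent_0123[of a] frob_permanent_0123[of b] perm(1) a24 by (simp add: b)
  note quad = this
  have "a 3 ^ (1 + q ^ 3) = 1" using a33 by simp
  from quad[unfolded a15 this]
  have "a 1 * a 1 ^ q * a 1 ^ (q ^ 2) * a 3 ^ (q ^ 3) + a 3 * a 5 ^ q * a 5 ^ (q ^ 2) * a 5 ^ (q ^ 3)
      = 1 + \<delta> ^ q * \<delta> ^ (q ^ 2) * \<delta> ^ (q ^ 3)"
    by (simp add: power_add mult.assoc)
  note perm_a = this
  have "x ^ q = x \<and> (5::'a) = 0"
    by (rule c.support_135_forces_char_5[OF _ _ _ _ assms(2) a15 a33 perm_a, of d t])
       (use eqs(1) a24 in simp, use eqs(2) a24 in simp, use eqs(4) a24 in simp,
        use eqs(5) a24 in simp)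
  then show False using assms(3) fixed by blast
qed

end

theorem corollary3p11:
  fixes q :: nat and h :: "'a::{field, finite}"
  assumes "primepow q" and "odd q"
    and "CARD('a) = q ^ 6"
    and "h ^ (q ^ 3 + 1) = -1"
    and "\<not> (h \<in> subfield_of_order q \<and> (\<exists>k. q = 5 ^ k))"
  shows "\<not> PGammaL_equivalent (L_h q h) (L1 q) \<and>
    (\<forall>\<delta>::'a. ff_norm q 1 \<delta> \<notin> {0, 1} \<longrightarrow>
       \<not> PGammaL_equivalent (L_h q h) (L2 q \<delta>)) \<and>
    (\<forall>\<delta>::'a. ff_norm q 3 \<delta> \<notin> {0, 1} \<and> maximum_scattered q (L3 q \<delta>) \<longrightarrow>
       \<not> PGammaL_equivalent (L_h q h) (L3 q \<delta>)) \<and>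
    (\<forall>\<delta>::'a. \<delta>\<^sup>2 + \<delta> = 1 \<longrightarrow>
       \<not> PGammaL_equivalent (L_h q h) (L4 q \<delta>))"
proof -
  interpret sextic_field q "TYPE('a)"
    using assms(1-3) by unfold_locales
  have norm_0: "ff_norm q e (0::'a) = 0" if "e = 1 \<or> e = 3" for e
    using that by (auto simp: ff_norm_def frob_zero prod_zero_iff)
  have not_5: "\<not> (h ^ q = h \<and> (5::'a) = 0)"
  proof
    assume *: "h ^ q = h \<and> (5::'a) = 0"
    obtain k where k: "prime CHAR('a)" "0 < k" "q = CHAR('a) ^ k" by (rule char_power)
    have "of_nat 5 = (0::'a)" using * by simp
    then have "CHAR('a) dvd 5" by (simp only: of_nat_eq_0_iff_char_dvd)
    moreover have "prime (5::nat)" by simp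
    ultimately have "CHAR('a) = 5" using k(1) primes_dvd_imp_eq by blast
    then show False using assms(5) k(3) * by (auto simp: subfield_of_order_def)
  qed
  show ?thesis
  proof (intro conjI allI impI)
    show "\<not> PGammaL_equivalent (L_h q h) (L1 q)"
      by (rule not_equivalent_L1[OF assms(4)])
  next
    fix \<delta> :: 'a assume "ff_norm q 1 \<delta> \<notin> {0, 1}"
    then have "\<delta> \<noteq> 0" using norm_0 by auto
    then show "\<not> PGammaL_equivalent (L_h q h) (L2 q \<delta>)"
      by (rule not_equivalent_L2[OF assms(4)])
  next
    fix \<delta> :: 'a assume "ff_norm q 3 \<delta> \<notin> {0, 1} \<and> maximum_scattered q (L3 q \<delta>)"
    then have "\<delta> \<noteq> 0" using norm_0 by auto
    then show "\<not> PGammaL_equivalent (L_h q h) (L3 q \<delta>)"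
      by (rule not_equivalent_L3[OF assms(4)])
  next
    fix \<delta> :: 'a assume "\<delta>\<^sup>2 + \<delta> = 1"
    then show "\<not> PGammaL_equivalent (L_h q h) (L4 q \<delta>)"
      by (rule not_equivalent_L4[OF assms(4) _ not_5])
  qed
qed

end
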